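(* Assume: (i) $\|A\|_\infty<\infty$, $\|B_0\|_\infty<\infty$, $\|B\|_\infty<\infty$; (ii) for any $\lambda\ge0$, $q_\lambda(0)=0$, $q_\lambda$ is right-continuous at $0$ and differentiable on $(0,\infty)$, and $\sup_{\lambda>0}\sup_{x>0}|q'_\lambda(x)|/\lambda<\infty$; (iii) $\theta_\star\in\mathcal M$ and for every $s\in\mathcal S$ the set $\{\ell\in\mathcal S\setminus\{s\}:\ \theta_\star(s,\ell)\ne0\}$ is finite; (iv) $n^{-1}\lambda_n=o(1)$ as $n\to\infty$. Then, $\check{\mathbb P}_\star$-almost surely, $U_n$ epi-converges to $k(\theta_\star,\cdot)$ in $(\mathcal M_1,\|\cdot\|_1)$.
   Context: Setting. $\mathsf X$ is a compact subset of a Euclidean space with Borel sigma-algebra and a finite (non-zero) measure $\rho$; $du$ stands for $\rho(du)$ and densities are with respect to $\rho$. $A,B_0:\mathsf X\to\mathbb R$, $B:\mathsf X\times\mathsf X\to\mathbb R$ are measurable, $B(x,y)=B(y,x)$, $B(x,x)=B_0(x)$. $\mathcal S$ is a countably infinite set with a linear ordering $\succeq$. For $\Lambda\subseteq\mathcal S$, $\underline\Lambda^2=\{(s,\ell)\in\Lambda\times\Lambda:\ \ell\succeq s\}$. $\mathcal M$ is the space of symmetric infinite matrices $\theta:\mathcal S\times\mathcal S\to\mathbb R$ with $\sum_{\ell\ne s}|\theta(s,\ell)|<\infty$ for all $s\in\mathcal S$. $\mathcal M_1$ is the Banach space of $\theta\in\mathcal M$ with $\|\theta\|_1=\sum_{(s,\ell)\in\underline{\mathcal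 S}^2}|\theta(s,\ell)|<\infty$. Full conditional densities: for $\theta\in\mathcal M$, $s\in\mathcal S$, $u\in\mathsf X$, $x\in\mathsf X^{\mathcal S\setminus\{s\}}$, $$f^{(s)}_\theta(u\mid x)=\frac1{Z^{(s)}_\theta}\exp\Big\{A(u)+\theta(s,s)B_0(u)+\sum_{\ell\in\mathcal S\setminus\{s\}}\theta(s,\ell)B(u,x_\ell)\Big\},$$ $Z^{(s)}_\theta=Z_\theta^{(s)}(x)$ the normalizing constant. $\mu_\theta$ denotes a probability measure on $\mathsf X^{\mathcal S}$ (product sigma-algebra) such that, if $\{X_s\}_{s\in\mathcal S}\sim\mu_\theta$, then for every $s$ the conditional distribution of $X_s$ given $\{X_\ell,\ell\neq s\}$ has density $f^{(s)}_\theta(\cdot\mid X_{\mathcal S\setminus\{s\}})$; such a measure exists (possibly not unique; one is fixed). $\mathbb E_{\theta}$ is expectation under $\mu_{\theta}$. $\theta_\star$ is the true matrix; $X^{(1)},X^{(2)},\dots$ are i.i.d. with law $\mu_{\theta_\star}$ on a probability space with probability $\check{\mathbb P}_\star$. $\{D_n\}$ is an increasing sequence of finite subsets of $\mathcal S$ with union $\mathcal S$. With $\partial_n s=D_n\setminus\{s\}$, the approximate conditional densities are, for $s\in D_n$, $$f^{(s)}_\theta(u\mid x_{\partial_n s})=\frac1{Z^{(s)}_{n,\theta}}\exp\Big(A(u)+\theta(s,s)B_0(u)+\sum_{\ell\in\partial_n s}\theta(s,\ell)B(u,x_\ell)\Big),$$ with $Z^{(s)}_{n,\theta}$ the normalizing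 constant. $q_\lambda:[0,\infty)\to[0,\infty)$, $\lambda\ge0$, are penalty functions and $\lambda_n>0$. For $\theta\in\mathcal M_1$, $$U_n(\theta)=\frac1n\sum_{i=1}^n\sum_{s\in D_n}\Big(\log f^{(s)}_{\theta_\star}(X^{(i)}_s\mid X^{(i)}_{\partial_n s})-\log f^{(s)}_{\theta_\star+\theta}(X^{(i)}_s\mid X^{(i)}_{\partial_n s})\Big)+\frac1n\sum_{(s,\ell)\in\underline D_n^2}\Big(q_{\lambda_n}(|\theta_\star(s,\ell)+\theta(s,\ell)|)-q_{\lambda_n}(|\theta_\star(s,\ell)|)\Big),$$ $$k^{(s)}(\theta_\star,\theta)=\mathbb E_{\theta_\star}\Big(\int-\log\Big(\frac{f^{(s)}_{\theta_\star+\theta}(u\mid X_{\mathcal S\setminus\{s\}})}{f^{(s)}_{\theta_\star}(u\mid X_{\mathcal S\setminus\{s\}})}\Big)f^{(s)}_{\theta_\star}(u\mid X_{\mathcal S\setminus\{s\}})\,du\Big),\qquad k(\theta_\star,\theta)=\sum_{s\in\mathcal S}k^{(s)}(\theta_\star,\theta).$$ Epi-convergence: for functions $f,f_n$ on a metric space $\mathsf V$ with values in $[-\infty,\infty]$, with $B(x,r)$ the open ball of center $x$ and radius $r$ in $\mathsf V$, put $\mathrm{li}_e f_n(x)=\sup_{k\ge1}\liminf_{n\to\infty}\inf_{v\in B(x,k^{-1})}f_n(v)$ and $\mathrm{ls}_e f_n(x)=\sup_{k\ge1}\limsup_{n\to\infty}\inf_{v\in B(x,k^{-1})}f_n(v)$.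 $f_n$ epi-converges to $f$ if $\mathrm{ls}_e f_n(x)\le f(x)\le\mathrm{li}_e f_n(x)$ for all $x\in\mathsf V$. *)

theory Defs
  imports "HOL-Probability.Probability"
begin

definition sup_norm :: "'b set \<Rightarrow> ('b \<Rightarrow> real) \<Rightarrow> ereal"
  where "sup_norm X f = (SUP x\<in>X. ereal \<bar>f x\<bar>)"

definition ordered_pairs :: "'s::linorder set \<Rightarrow> ('s \<times> 's) set"
  where "ordered_pairs \<Lambda> = {(s, l). s \<in> \<Lambda> \<and> l \<in> \<Lambda> \<and> s \<le> l}"

definition matrices :: "('s \<Rightarrow> 's \<Rightarrow> real) set"
  where "matrices = {\<theta>. (\<forall>s l. \<theta> s l = \<theta> l s) \<and>
                        (\<forall>s. (\<lambda>l. \<bar>\<theta> s l\<bar>) summable_on (UNIV - {s}))}"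

definition norm_M1 :: "('s::linorder \<Rightarrow> 's \<Rightarrow> real) \<Rightarrow> real"
  where "norm_M1 \<theta> = (\<Sum>\<^sub>\<infinity>(s, l)\<in>ordered_pairs UNIV. \<bar>\<theta> s l\<bar>)"

(* norm_M1 only carries information on matrices whose entries are absolutely
   summable, so finiteness of the norm is expressed by summability. *)
definition M1 :: "('s::linorder \<Rightarrow> 's \<Rightarrow> real) set"
  where "M1 = {\<theta> \<in> matrices. (\<lambda>(s, l). \<bar>\<theta> s l\<bar>) summable_on ordered_pairs UNIV}"

definition dist_M1 :: "('s::linorder \<Rightarrow> 's \<Rightarrow> real) \<Rightarrow> ('s \<Rightarrow> 's \<Rightarrow> real) \<Rightarrow> real"
  where "dist_M1 \<theta> \<eta> = norm_M1 (\<lambda>s l. \<theta> s l - \<eta> s l)"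

lemma summable_diff_M1:
  assumes "\<theta> \<in> M1" "\<eta> \<in> M1"
  shows "(\<lambda>(s, l). \<bar>\<theta> s l - \<eta> s l\<bar>) summable_on ordered_pairs UNIV"
proof (rule summable_on_comparison_test)
  show "(\<lambda>p. (\<lambda>(s, l). \<bar>\<theta> s l\<bar>) p + (\<lambda>(s, l). \<bar>\<eta> s l\<bar>) p) summable_on ordered_pairs UNIV"
    using assms by (intro summable_on_add) (auto simp: M1_def)
qed auto

lemma Metric_space_M1: "Metric_space M1 dist_M1"
proof
  fix \<theta> \<eta> :: "'s::linorder \<Rightarrow> 's \<Rightarrow> real"
  show "0 \<le> dist_M1 \<theta> \<eta>"
    unfolding dist_M1_def norm_M1_def by (rule infsum_nonneg) auto
  show "dist_M1 \<theta> \<eta> = dist_M1 \<eta> \<theta>"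
    unfolding dist_M1_def norm_M1_def by (simp add: abs_minus_commute)
next
  fix \<theta> \<eta> :: "'s::linorder \<Rightarrow> 's \<Rightarrow> real"
  assume mem: "\<theta> \<in> M1" "\<eta> \<in> M1"
  show "dist_M1 \<theta> \<eta> = 0 \<longleftrightarrow> \<theta> = \<eta>"
  proof
    assume z: "dist_M1 \<theta> \<eta> = 0"
    have upper: "\<theta> s l = \<eta> s l" if "s \<le> l" for s l
    proof -
      have "(\<lambda>(s, l). \<bar>\<theta> s l - \<eta> s l\<bar>) (s, l) = 0"
        by (rule nonneg_infsum_le_0D[OF _ summable_diff_M1[OF mem]])
           (use z that in \<open>auto simp: dist_M1_def norm_M1_def ordered_pairs_def\<close>)
      then show ?thesis by simp
    qed
    have "\<theta> s l = \<eta> s l" for s l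
    proof (cases "s \<le> l")
      case False
      then have "\<theta> l s = \<eta> l s" by (intro upper) simp
      moreover have "\<theta> s l = \<theta> l s" "\<eta> s l = \<eta> l s"
        using mem by (auto simp: M1_def matrices_def)
      ultimately show ?thesis by simp
    qed (rule upper)
    then show "\<theta> = \<eta>" by blast
  qed (simp add: dist_M1_def norm_M1_def case_prod_unfold)
next
  fix \<theta> \<eta> \<zeta> :: "'s::linorder \<Rightarrow> 's \<Rightarrow> real"
  assume mem: "\<theta> \<in> M1" "\<eta> \<in> M1" "\<zeta> \<in> M1"
  let ?P = "ordered_pairs (UNIV :: 's set)"
  have "dist_M1 \<theta> \<zeta> \<le> (\<Sum>\<^sub>\<infinity>p\<in>?P. (\<lambda>(s, l). \<bar>\<theta> s l - \<eta> s l\<bar>) p + (\<lambda>(s, l). \<bar>\<eta> s l - \<zeta> s l\<bar>) p)"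
    unfolding dist_M1_def norm_M1_def
    by (intro infsum_mono summable_on_add summable_diff_M1 mem) auto
  also have "\<dots> = dist_M1 \<theta> \<eta> + dist_M1 \<eta> \<zeta>"
    unfolding dist_M1_def norm_M1_def
    by (intro infsum_add summable_diff_M1 mem)
  finally show "dist_M1 \<theta> \<zeta> \<le> dist_M1 \<theta> \<eta> + dist_M1 \<eta> \<zeta>" .
qed

definition M1_metric :: "('s::linorder \<Rightarrow> 's \<Rightarrow> real) metric"
  where "M1_metric = metric (M1, dist_M1)"

lemma mspace_M1_metric [simp]: "mspace M1_metric = M1"
  and mdist_M1_metric [simp]: "mdist M1_metric = dist_M1"
  by (simp_all add: M1_metric_def Metric_space_M1 Metric_space.mspace_metric Metric_space.mdist_metric)

definition madd :: "('s \<Rightarrow> 's \<Rightarrow> real) \<Rightarrow> ('s \<Rightarrow> 's \<Rightarrow> real) \<Rightarrow> 's \<Rightarrow> 's \<Rightarrow> real"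
  where "madd \<theta> \<eta> = (\<lambda>s l. \<theta> s l + \<eta> s l)"

(* The conditional density of the coordinate s at u given the values x l, l \<in> \<Lambda> - {s}.
   \<Lambda> = UNIV gives the full conditional density, and \<Lambda> = D n (where the infinite sum is
   a finite one) gives the approximate conditional density. Coordinates of x outside
   \<Lambda> - {s} are not used. *)
definition cond_energy ::
  "('a \<Rightarrow> real) \<Rightarrow> ('a \<Rightarrow> real) \<Rightarrow> ('a \<Rightarrow> 'a \<Rightarrow> real) \<Rightarrow> 's set \<Rightarrow>
   ('s \<Rightarrow> 's \<Rightarrow> real) \<Rightarrow> 's \<Rightarrow> 'a \<Rightarrow> ('s \<Rightarrow> 'a) \<Rightarrow> real"
  where "cond_energy A B0 B \<Lambda> \<theta> s u x =
    A u + \<theta> s s * B0 u + (\<Sum>\<^sub>\<infinity>l\<in>\<Lambda> - {s}. \<theta> s l * B u (x l))"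

definition cond_density ::
  "'a measure \<Rightarrow> ('a \<Rightarrow> real) \<Rightarrow> ('a \<Rightarrow> real) \<Rightarrow> ('a \<Rightarrow> 'a \<Rightarrow> real) \<Rightarrow> 's set \<Rightarrow>
   ('s \<Rightarrow> 's \<Rightarrow> real) \<Rightarrow> 's \<Rightarrow> 'a \<Rightarrow> ('s \<Rightarrow> 'a) \<Rightarrow> real"
  where "cond_density \<rho> A B0 B \<Lambda> \<theta> s u x =
    exp (cond_energy A B0 B \<Lambda> \<theta> s u x) / (\<integral>v. exp (cond_energy A B0 B \<Lambda> \<theta> s v x) \<partial>\<rho>)"

(* Sub-sigma-algebra of the product space generated by the coordinates other than s. *)
definition others_algebra :: "'a measure \<Rightarrow> 's \<Rightarrow> ('s \<Rightarrow> 'a) measure"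
  where "others_algebra \<rho> s =
    vimage_algebra (space (Pi\<^sub>M UNIV (\<lambda>_. \<rho>))) (\<lambda>x. restrict x (UNIV - {s}))
      (Pi\<^sub>M (UNIV - {s}) (\<lambda>_. \<rho>))"

(* \<mu> is a law on the product space under which the conditional distribution of the
   coordinate s given all the others has density cond_density with respect to \<rho>:
   \<mu>(X_s \<in> E | X_l, l \<noteq> s) = \<integral>_E f(u | X) \<rho>(du) almost surely, for every measurable E. *)
definition has_full_conditionals ::
  "'a measure \<Rightarrow> ('a \<Rightarrow> real) \<Rightarrow> ('a \<Rightarrow> real) \<Rightarrow> ('a \<Rightarrow> 'a \<Rightarrow> real) \<Rightarrow>
   ('s \<Rightarrow> 's \<Rightarrow> real) \<Rightarrow> ('s \<Rightarrow> 'a) measure \<Rightarrow> bool"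
  where "has_full_conditionals \<rho> A B0 B \<theta> \<mu> \<longleftrightarrow>
    prob_space \<mu> \<and> sets \<mu> = sets (Pi\<^sub>M UNIV (\<lambda>_. \<rho>)) \<and>
    (\<forall>s. \<forall>E\<in>sets \<rho>. AE x in \<mu>.
       real_cond_exp \<mu> (others_algebra \<rho> s) (\<lambda>y. indicator E (y s)) x =
       (LINT u:E|\<rho>. cond_density \<rho> A B0 B UNIV \<theta> s u x))"

(* x i is the i-th observation; observations are numbered from 1. *)
definition U ::
  "'a measure \<Rightarrow> ('a \<Rightarrow> real) \<Rightarrow> ('a \<Rightarrow> real) \<Rightarrow> ('a \<Rightarrow> 'a \<Rightarrow> real) \<Rightarrow>
   (nat \<Rightarrow> 's::linorder set) \<Rightarrow> (real \<Rightarrow> real \<Rightarrow> real) \<Rightarrow> (nat \<Rightarrow> real) \<Rightarrow>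
   ('s \<Rightarrow> 's \<Rightarrow> real) \<Rightarrow> (nat \<Rightarrow> 's \<Rightarrow> 'a) \<Rightarrow> nat \<Rightarrow> ('s \<Rightarrow> 's \<Rightarrow> real) \<Rightarrow> real"
  where "U \<rho> A B0 B D q lam \<theta>\<^sub>0 x n \<theta> =
    1 / real n * (\<Sum>i = 1..n. \<Sum>s\<in>D n.
        ln (cond_density \<rho> A B0 B (D n) \<theta>\<^sub>0 s (x i s) (x i))
      - ln (cond_density \<rho> A B0 B (D n) (madd \<theta>\<^sub>0 \<theta>) s (x i s) (x i)))
  + 1 / real n * (\<Sum>(s, l)\<in>ordered_pairs (D n).
        q (lam n) \<bar>\<theta>\<^sub>0 s l + \<theta> s l\<bar> - q (lam n) \<bar>\<theta>\<^sub>0 s l\<bar>)"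

definition k_site ::
  "'a measure \<Rightarrow> ('a \<Rightarrow> real) \<Rightarrow> ('a \<Rightarrow> real) \<Rightarrow> ('a \<Rightarrow> 'a \<Rightarrow> real) \<Rightarrow> ('s \<Rightarrow> 'a) measure \<Rightarrow>
   ('s \<Rightarrow> 's \<Rightarrow> real) \<Rightarrow> ('s \<Rightarrow> 's \<Rightarrow> real) \<Rightarrow> 's \<Rightarrow> real"
  where "k_site \<rho> A B0 B \<mu> \<theta>\<^sub>0 \<theta> s =
    (\<integral>x. (\<integral>u. - ln (cond_density \<rho> A B0 B UNIV (madd \<theta>\<^sub>0 \<theta>) s u x /
                      cond_density \<rho> A B0 B UNIV \<theta>\<^sub>0 s u x)
              * cond_density \<rho> A B0 B UNIV \<theta>\<^sub>0 s u x \<partial>\<rho>) \<partial>\<mu>)"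

(* The sum is taken in ereal, so that it is \<infinity> and not 0 if the (nonnegative) summands
   are not summable. *)
definition k_total ::
  "'a measure \<Rightarrow> ('a \<Rightarrow> real) \<Rightarrow> ('a \<Rightarrow> real) \<Rightarrow> ('a \<Rightarrow> 'a \<Rightarrow> real) \<Rightarrow> ('s \<Rightarrow> 'a) measure \<Rightarrow>
   ('s \<Rightarrow> 's \<Rightarrow> real) \<Rightarrow> ('s \<Rightarrow> 's \<Rightarrow> real) \<Rightarrow> ereal"
  where "k_total \<rho> A B0 B \<mu> \<theta>\<^sub>0 \<theta> = (\<Sum>\<^sub>\<infinity>s\<in>UNIV. ereal (k_site \<rho> A B0 B \<mu> \<theta>\<^sub>0 \<theta> s))"

definition epi_liminf :: "'v metric \<Rightarrow> (nat \<Rightarrow> 'v \<Rightarrow> ereal) \<Rightarrow> 'v \<Rightarrow> ereal"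
  where "epi_liminf V f x =
    (SUP k\<in>{1::nat..}. liminf (\<lambda>n. INF v\<in>mball_of V x (1 / real k). f n v))"

definition epi_limsup :: "'v metric \<Rightarrow> (nat \<Rightarrow> 'v \<Rightarrow> ereal) \<Rightarrow> 'v \<Rightarrow> ereal"
  where "epi_limsup V f x =
    (SUP k\<in>{1::nat..}. limsup (\<lambda>n. INF v\<in>mball_of V x (1 / real k). f n v))"

definition epi_converges :: "'v metric \<Rightarrow> (nat \<Rightarrow> 'v \<Rightarrow> ereal) \<Rightarrow> ('v \<Rightarrow> ereal) \<Rightarrow> bool"
  where "epi_converges V fn f \<longleftrightarrow>
    (\<forall>x\<in>mspace V. epi_limsup V fn x \<le> f x \<and> f x \<le> epi_liminf V fn x)"

end

theory Submission
  imports Defs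
begin

text \<open>
  For bounded interactions, changing \<open>\<theta>\<close> to \<open>\<eta>\<close> moves every log conditional density at a site by at
  most a constant times the absolute sum of that row of \<open>\<theta> - \<eta>\<close>. Summing over the sites, both \<open>U\<^sub>n\<close>
  and \<open>k(\<theta>\<^sub>0, \<cdot>)\<close> are Lipschitz for the \<open>\<M>\<^sub>1\<close>-distance, uniformly in \<open>n\<close>, since the penalty
  contributes a Lipschitz constant of order \<open>\<lambda>\<^sub>n / n\<close>. Uniformly Lipschitz functions that converge
  pointwise on a dense set epi-converge, so it suffices to treat the countably many rational matrices
  of finite support. For such a matrix only finitely many sites and neighbours matter, the
  approximate conditional densities are eventually exact, and the strong law of large numbers for
  bounded variables applies at each site. The limit is identified as \<open>k\<^sup>(\<^sup>s\<^sup>)\<close> because resampling a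
  coordinate from its conditional density preserves \<open>\<mu>\<close>.
\<close>

section \<open>Laws of large numbers, Lipschitz bounds and epi-convergence\<close>

text \<open>Two obstacles shape the argument: epi-limits involve infima over balls of an
  infinite-dimensional space, and the almost sure statement concerns uncountably many
  \<open>\<theta>\<close> at once. A Lipschitz constant independent of \<open>n\<close> removes
  both: on a ball of radius \<open>1/k\<close> all values lie within \<open>L/k\<close> of the value
  at the centre, and one null set for each point of a countable dense set is enough. The constant
  \<open>4 * C\<close> is 2 times 2. The energy and the logarithm of the normalizing constant each
  move by at most \<open>C\<close> times the row norm of the perturbation, and an off-diagonal entry
  lies in two rows but is counted once in the norm of \<open>M1\<close>. The law of large numbers is
  applied to the log ratio with the observed \<open>x s\<close> inserted, whereas
  \<open>k_site\<close> integrates over a fresh \<open>u\<close>. Resampling closes this gap; since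
  conditional laws are given only through conditional expectations of indicators, the identity is
  first proved on cylinders.\<close>

text \<open>Boundedness allows Hoeffding's inequality, whose tail bounds are geometric in
  \<open>n\<close>; Borel-Cantelli then gives almost sure convergence for each fixed
  tolerance.\<close>

lemma (in prob_space) strong_law_bounded:
  fixes Y :: "nat \<Rightarrow> 'a \<Rightarrow> real"
  assumes indep: "indep_vars (\<lambda>_. borel) Y {1..}"
    and bound: "\<And>i \<omega>. i \<ge> 1 \<Longrightarrow> \<omega> \<in> space M \<Longrightarrow> \<bar>Y i \<omega>\<bar> \<le> c"
    and mean: "\<And>i. i \<ge> 1 \<Longrightarrow> expectation (Y i) = m"
  shows "AE \<omega> in M. (\<lambda>n. 1 / real n * (\<Sum>i=1..n. Y i \<omega>)) \<longlonglongrightarrow> m"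
proof -
  \<comment> \<open>Adding 1 keeps the range \<open>[-b, b]\<close> nondegenerate, as the Hoeffding
    bound divides by its width.\<close>
  define b where "b = \<bar>c\<bar> + 1"
  have b: "b > 0" by (simp add: b_def)
  have [measurable]: "random_variable borel (Y i)" if "i \<ge> 1" for i
    using indep that by (auto simp: indep_vars_def)
  define dev where "dev e n = {\<omega> \<in> space M. \<bar>(\<Sum>i=1..n. Y i \<omega>) - real n * m\<bar> \<ge> real n * e}" for e n
  have sets_dev: "dev e n \<in> sets M" for e n
    unfolding dev_def by measurable
  have dev_le: "prob (dev e n) \<le> 2 * exp (- (e\<^sup>2 / (2 * b\<^sup>2))) ^ n" if e: "e > 0" for e n
  proof (cases "n = 0")
    \<comment> \<open>For \<open>n = 0\<close> the right-hand side is 2, which exceeds any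
      probability.\<close>
    case True
    then show ?thesis by (auto intro: order.trans[OF prob_le_1])
  next
    case False
    have Ind: "indep_vars (\<lambda>_. borel) Y {1..n}"
      by (rule indep_vars_subset[OF indep]) auto
    interpret H: Hoeffding_ineq M "{1..n}" Y "\<lambda>_. -b" "\<lambda>_. b" "real n * m"
    proof unfold_locales
    show "AE \<omega> in M. Y i \<omega> \<in> {- b..b}" if "i \<in> {1..n}" for i
      using bound[of i] that by (intro AE_I2) (force simp: b_def)
    show "real n * m \<equiv> \<Sum>i=1..n. expectation (Y i)"
      by (rule eq_reflection) (use mean in simp)
  qed (use Ind in auto)
    have "prob (dev e n) \<le> 2 * exp (-2 * (real n * e)\<^sup>2 / (\<Sum>i=1..n. (b - (- b))\<^sup>2))"
      unfolding dev_def using b False e by (intro H.Hoeffding_ineq_abs_ge) auto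
    \<comment> \<open>Each of the \<open>n\<close> ranges has width \<open>2 * b\<close>, so one
      factor \<open>n\<close> survives and the bound is a power of a number below 1.\<close>
    also have "-2 * (real n * e)\<^sup>2 / (\<Sum>i=1..n. (b - (- b))\<^sup>2) = real n * (- (e\<^sup>2 / (2 * b\<^sup>2)))"
      using False b by (simp add: field_simps power2_eq_square)
    finally show ?thesis by (simp only: exp_of_nat_mult)
  qed
  have ev: "AE \<omega> in M. \<forall>\<^sub>F n in sequentially. \<omega> \<in> space M - dev e n" if e: "e > 0" for e
  proof (rule borel_cantelli_AE1)
    have "summable (\<lambda>n. 2 * exp (- (e\<^sup>2 / (2 * b\<^sup>2))) ^ n)"
      using e b by (intro summable_mult summable_geometric) auto
    then show "summable (\<lambda>n. prob (dev e n))"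
      by (rule summable_comparison_test[rotated]) (use dev_le[OF e] in auto)
  qed (auto simp: sets_dev less_top[symmetric])
  \<comment> \<open>Countably many tolerances \<open>1 / Suc j\<close> suffice, so the exceptional
    null sets can be united.\<close>
  have "AE \<omega> in M. \<forall>j. \<forall>\<^sub>F n in sequentially. \<omega> \<in> space M - dev (1 / real (Suc j)) n"
    by (subst AE_all_countable) (intro allI ev, simp)
  then show ?thesis
  proof eventually_elim
    case (elim \<omega>)
    show ?case
    proof (rule tendstoI)
      fix e :: real assume "e > 0"
      then obtain j where j: "1 / real (Suc j) < e"
        by (meson nat_approx_posE)
      have "\<forall>\<^sub>F n in sequentially. \<omega> \<in> space M - dev (1 / real (Suc j)) n \<and> n \<ge> 1"
        using elim by (intro eventually_conj eventually_ge_at_top) auto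
      then show "\<forall>\<^sub>F n in sequentially. dist (1 / real n * (\<Sum>i=1..n. Y i \<omega>)) m < e"
      proof eventually_elim
        case (elim n)
        let ?S = "\<Sum>i=1..n. Y i \<omega>"
        have n: "real n > 0" using elim by simp
        have "\<bar>?S - real n * m\<bar> < real n * (1 / real (Suc j))"
          using elim by (auto simp: dev_def)
        also have "\<dots> < real n * e"
          using n j by (intro mult_strict_left_mono)
        finally have "\<bar>?S - real n * m\<bar> / real n < e"
          using n by (simp add: divide_less_eq mult.commute)
        also have "\<bar>?S - real n * m\<bar> / real n = \<bar>(?S - real n * m) / real n\<bar>" by simp
        also have "(?S - real n * m) / real n = 1 / real n * ?S - m"
          using n by (simp add: field_simps)
        finally show ?case by (simp add: dist_real_def)
      qed
    qed
  qed
qed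

text \<open>This is the mean value theorem on \<open>[a, b]\<close>. Penalties are evaluated at
  absolute values only, so at the endpoint 0 continuity from the right is what the theorem asks
  for.\<close>

lemma deriv_bounded_imp_lipschitz_nonneg:
  fixes f :: "real \<Rightarrow> real"
  assumes right_cont: "continuous (at_right 0) f"
    and diff: "\<And>x. x > 0 \<Longrightarrow> f differentiable at x"
    and bound: "\<And>x. x > 0 \<Longrightarrow> \<bar>deriv f x\<bar> \<le> K"
    and "a \<ge> 0" "b \<ge> 0"
  shows "\<bar>f a - f b\<bar> \<le> K * \<bar>a - b\<bar>"
proof -
  have *: "\<bar>f b - f a\<bar> \<le> K * (b - a)" if ab: "0 \<le> a" "a < b" for a b
  proof -
    have der: "(f has_field_derivative deriv f x) (at x)" if "x > 0" for x
      using diff[OF that] by (metis DERIV_imp_deriv real_differentiable_def)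
    have cont: "continuous_on {a..b} f"
      unfolding continuous_on_eq_continuous_within
    proof
      fix x assume x: "x \<in> {a..b}"
      show "continuous (at x within {a..b}) f"
      proof (cases "x = 0")
        case True
        with ab x have "at x within {a..b} = at_right 0"
          by (simp add: at_within_Icc_at_right)
        with right_cont show ?thesis by (simp add: continuous_within)
      next
        case False
        with x that have "isCont f x" by (intro DERIV_isCont[OF der]) auto
        then show ?thesis by (rule continuous_at_imp_continuous_at_within)
      qed
    qed
    obtain z where "a < z" "z < b" "f b - f a = (\<lambda>h. deriv f z * h) (b - a)"
    proof (rule mvt[OF ab(2) cont])
      fix x assume "a < x" "x < b"
      with ab have "x > 0" by simp
      then show "(f has_derivative (\<lambda>h. deriv f x * h)) (at x)"
        using der by (simp add: has_field_derivative_def)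
    qed
    then show ?thesis using bound[of z] ab by (simp add: abs_mult mult.commute mult_right_mono)
  qed
  show ?thesis
    using *[of a b] *[of b a] assms(4,5) by (cases a b rule: linorder_cases) (auto simp: abs_minus_commute)
qed

text \<open>A common Lipschitz constant carries convergence from \<open>Q\<close> to every point and
  makes the infimum over a small ball nearly the value at its centre. The upper bound tests the
  infimum at the centre; the lower bound loses at most \<open>M / k\<close>.\<close>

lemma epi_converges_if_lipschitz:
  fixes f :: "nat \<Rightarrow> 'v \<Rightarrow> real" and g :: "'v \<Rightarrow> real"
  assumes lip_f: "\<And>n x y. x \<in> mspace V \<Longrightarrow> y \<in> mspace V \<Longrightarrow> \<bar>f n x - f n y\<bar> \<le> L * mdist V x y"
    and lip_g: "\<And>x y. x \<in> mspace V \<Longrightarrow> y \<in> mspace V \<Longrightarrow> \<bar>g x - g y\<bar> \<le> L * mdist V x y"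
    and dense: "\<And>x e. x \<in> mspace V \<Longrightarrow> e > 0 \<Longrightarrow> \<exists>d\<in>Q. mdist V x d < e"
    and Q: "Q \<subseteq> mspace V" "\<And>d. d \<in> Q \<Longrightarrow> (\<lambda>n. f n d) \<longlonglongrightarrow> g d"
  shows "epi_converges V (\<lambda>n x. ereal (f n x)) (\<lambda>x. ereal (g x))"
  unfolding epi_converges_def
proof (intro ballI conjI)
  fix x assume x: "x \<in> mspace V"
  \<comment> \<open>A strictly positive constant is needed, since the tolerances below divide by
    it.\<close>
  define M where "M = max L 1"
  have M: "M > 0" "L \<le> M" by (auto simp: M_def)
  have lip_f': "\<bar>f n x - f n y\<bar> \<le> M * mdist V x y" if "x \<in> mspace V" "y \<in> mspace V" for n x y
    using lip_f[OF that, of n] mult_right_mono[OF M(2), of "mdist V x y"] by simp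
  have lip_g': "\<bar>g x - g y\<bar> \<le> M * mdist V x y" if "x \<in> mspace V" "y \<in> mspace V" for x y
    using lip_g[OF that] mult_right_mono[OF M(2), of "mdist V x y"] by simp
  have lim: "(\<lambda>n. f n x) \<longlonglongrightarrow> g x"
  proof (rule tendstoI)
    fix e :: real assume e: "e > 0"
    then obtain d where d: "d \<in> Q" "mdist V x d < e / (3 * M)"
      using dense[OF x, of "e / (3 * M)"] M by auto
    have dV: "d \<in> mspace V" using d(1) Q(1) by auto
    have small: "M * mdist V x d < e / 3"
      using d(2) M by (simp add: field_simps)
    \<comment> \<open>Three thirds of \<open>e\<close>: moving \<open>f n\<close> from
      \<open>x\<close> to \<open>d\<close>, convergence at \<open>d\<close>, and moving
      \<open>g\<close> back from \<open>d\<close> to \<open>x\<close>.\<close>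
    have "\<forall>\<^sub>F n in sequentially. dist (f n d) (g d) < e / 3"
      using Q(2)[OF d(1)] e by (intro tendstoD) auto
    then show "\<forall>\<^sub>F n in sequentially. dist (f n x) (g x) < e"
    proof eventually_elim
      case (elim n)
      then show ?case
        using lip_f'[OF x dV, of n] lip_g'[OF x dV] small unfolding dist_real_def by linarith
    qed
  qed
  have self: "mdist V x x = 0"
    using Metric_space.zero[OF Metric_space_mspace_mdist x x] by simp
  have in_ball: "x \<in> mball_of V x (1 / real k)" if "k \<ge> 1" for k :: nat
  proof -
    have "0 < 1 / real k" using that by simp
    then show ?thesis using x by (simp only: in_mball_of self simp_thms)
  qed
  show "epi_limsup V (\<lambda>n x. ereal (f n x)) x \<le> ereal (g x)"
    unfolding epi_limsup_def
  proof (rule SUP_least)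
    fix k :: nat assume k: "k \<in> {1..}"
    have "limsup (\<lambda>n. INF v\<in>mball_of V x (1 / real k). ereal (f n v)) \<le> limsup (\<lambda>n. ereal (f n x))"
      using in_ball[of k] k by (intro Limsup_mono always_eventually allI INF_lower) auto
    also have "\<dots> = ereal (g x)"
      using lim by (intro lim_imp_Limsup) auto
    finally show "limsup (\<lambda>n. INF v\<in>mball_of V x (1 / real k). ereal (f n v)) \<le> ereal (g x)" .
  qed
  have "ereal (g x - M / real k) \<le> epi_liminf V (\<lambda>n x. ereal (f n x)) x" if k: "k \<ge> 1" for k :: nat
  proof -
    have "(\<lambda>n. ereal (f n x - M / real k)) \<longlonglongrightarrow> ereal (g x - M / real k)"
      by (intro tendsto_ereal tendsto_diff lim tendsto_const)
    then have "ereal (g x - M / real k) = liminf (\<lambda>n. ereal (f n x - M / real k))"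
      by (intro lim_imp_Liminf[symmetric]) auto
    also have "\<dots> \<le> liminf (\<lambda>n. INF v\<in>mball_of V x (1 / real k). ereal (f n v))"
    proof (intro Liminf_mono always_eventually allI INF_greatest)
      fix n v assume "v \<in> mball_of V x (1 / real k)"
      then have v: "v \<in> mspace V" "mdist V x v < 1 / real k"
        by (auto simp: in_mball_of)
      have "M * mdist V x v \<le> M * (1 / real k)"
        using v(2) M by (intro mult_left_mono) auto
      then show "ereal (f n x - M / real k) \<le> ereal (f n v)"
        using lip_f'[OF x v(1), of n] by simp
    qed
    also have "\<dots> \<le> epi_liminf V (\<lambda>n x. ereal (f n x)) x"
      unfolding epi_liminf_def using k by (intro SUP_upper) auto
    finally show ?thesis .
  qed
  \<comment> \<open>The loss \<open>M / k\<close> vanishes as \<open>k\<close> grows, while the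
    epi-limit on the right is independent of \<open>k\<close>.\<close>
  then have ev: "\<forall>\<^sub>F k in sequentially. ereal (g x - M / real k) \<le> epi_liminf V (\<lambda>n x. ereal (f n x)) x"
    by (auto simp: eventually_sequentially)
  have "(\<lambda>k. ereal (g x - M / real k)) \<longlonglongrightarrow> ereal (g x - 0)"
    by (intro tendsto_ereal tendsto_diff tendsto_const lim_const_over_n)
  then show "ereal (g x) \<le> epi_liminf V (\<lambda>n x. ereal (f n x)) x"
    using ev by (intro tendsto_upperbound[of _ "ereal (g x)"]) auto
qed

section \<open>Matrices with summable rows\<close>

text \<open>The diagonal entry is included, so that a row is a single absolutely summable family.
  The notion concerns one row because truncating a row, as done below, destroys the symmetry
  demanded by \<open>matrices\<close>.\<close>

definition row_summable :: "('s \<Rightarrow> 's \<Rightarrow> real) \<Rightarrow> 's \<Rightarrow> bool"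
  where "row_summable \<theta> s \<longleftrightarrow> (\<lambda>l. \<bar>\<theta> s l\<bar>) summable_on UNIV"

lemma matrices_row_summable:
  assumes "\<theta> \<in> matrices"
  shows "row_summable \<theta> s"
proof -
  have "(\<lambda>l. \<bar>\<theta> s l\<bar>) summable_on insert s (UNIV - {s})"
    using assms by (subst summable_on_insert_iff) (auto simp: matrices_def)
  then show ?thesis by (simp add: insert_UNIV row_summable_def)
qed

lemma row_summable_zero [simp]: "row_summable (\<lambda>_ _. 0) s"
  by (simp add: row_summable_def)

lemma row_summable_diff:
  assumes "row_summable \<theta> s" "row_summable \<eta> s"
  shows "row_summable (\<lambda>s l. \<theta> s l - \<eta> s l) s"
  unfolding row_summable_def
proof (rule summable_on_comparison_test)
  show "(\<lambda>l. \<bar>\<theta> s l\<bar> + \<bar>\<eta> s l\<bar>) summable_on UNIV"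
    using assms by (intro summable_on_add) (auto simp: row_summable_def)
qed auto

lemma matrices_madd:
  assumes "\<theta> \<in> matrices" "\<eta> \<in> matrices"
  shows "madd \<theta> \<eta> \<in> matrices"
proof -
  have "(\<lambda>l. \<bar>\<theta> s l + \<eta> s l\<bar>) summable_on UNIV - {s}" for s
  proof (rule summable_on_comparison_test)
    show "(\<lambda>l. \<bar>\<theta> s l\<bar> + \<bar>\<eta> s l\<bar>) summable_on UNIV - {s}"
      using assms by (intro summable_on_add) (auto simp: matrices_def)
  qed auto
  then show ?thesis
    using assms by (auto simp: matrices_def madd_def)
qed

lemma M1_diff:
  assumes "\<theta> \<in> M1" "\<eta> \<in> M1"
  shows "(\<lambda>s l. \<theta> s l - \<eta> s l) \<in> M1"
proof -
  have "(\<lambda>l. \<bar>\<theta> s l - \<eta> s l\<bar>) summable_on UNIV - {s}" for s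
  proof (rule summable_on_comparison_test)
    show "(\<lambda>l. \<bar>\<theta> s l\<bar> + \<bar>\<eta> s l\<bar>) summable_on UNIV - {s}"
      using assms by (intro summable_on_add) (auto simp: M1_def matrices_def)
  qed auto
  with summable_diff_M1[OF assms] show ?thesis
    using assms by (auto simp: M1_def matrices_def)
qed

lemma M1_zero: "(\<lambda>_ _. 0) \<in> M1"
  by (simp add: M1_def matrices_def case_prod_unfold)

definition row_norm :: "('s \<Rightarrow> 's \<Rightarrow> real) \<Rightarrow> 's \<Rightarrow> real"
  where "row_norm \<theta> s = (\<Sum>\<^sub>\<infinity>l. \<bar>\<theta> s l\<bar>)"

lemma row_norm_nonneg: "row_norm \<theta> s \<ge> 0"
  unfolding row_norm_def by (rule infsum_nonneg) auto

text \<open>Summing row norms runs over all pairs, whereas \<open>norm_M1\<close> runs over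
  \<open>s \<le> l\<close>. By symmetry the remaining pairs contribute at most the same amount
  again, whence the factor 2.\<close>

lemma row_norm_M1:
  assumes "\<theta> \<in> M1"
  shows row_norm_summable: "row_norm \<theta> summable_on UNIV"
    and infsum_row_norm_le: "infsum (row_norm \<theta>) UNIV \<le> 2 * norm_M1 \<theta>"
proof -
  define f where "f = (\<lambda>(s, l). \<bar>\<theta> s l\<bar>)"
  let ?P = "ordered_pairs (UNIV :: 'a set)"
  have swap: "f \<circ> prod.swap = f"
    using assms by (auto simp: f_def M1_def matrices_def fun_eq_iff)
  have inj: "inj_on prod.swap ?P" by (auto simp: inj_on_def)
  have P: "f summable_on ?P" "infsum f ?P = norm_M1 \<theta>"
    using assms by (simp_all add: f_def M1_def norm_M1_def)
  have swap_P: "f summable_on prod.swap ` ?P" "infsum f (prod.swap ` ?P) = norm_M1 \<theta>"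
    using P by (simp_all only: summable_on_reindex[OF inj] infsum_reindex[OF inj] swap)
  \<comment> \<open>A pair below the diagonal is the swap of a pair above it; the inclusion is
    strict because the diagonal is its own swap, so only an inequality results.\<close>
  have sub: "- ?P \<subseteq> prod.swap ` ?P"
    by (auto simp: ordered_pairs_def image_iff)
  have compl: "f summable_on - ?P"
    by (rule summable_on_subset_banach[OF swap_P(1) sub])
  have U: "f summable_on UNIV"
    using summable_on_Un_disjoint[OF P(1) compl] by simp
  have "infsum f (- ?P) \<le> infsum f (prod.swap ` ?P)"
    using compl swap_P(1) sub by (rule infsum_mono2) (auto simp: f_def)
  then have le: "infsum f UNIV \<le> 2 * norm_M1 \<theta>"
    using infsum_Un_disjoint[OF P(1) compl] P swap_P by simp
  have U': "(\<lambda>(s, l). \<bar>\<theta> s l\<bar>) summable_on UNIV \<times> UNIV"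
    using U by (simp add: f_def)
  show "row_norm \<theta> summable_on UNIV"
    using summable_on_Sigma_banach[OF U'] by (simp add: row_norm_def[abs_def])
  show "infsum (row_norm \<theta>) UNIV \<le> 2 * norm_M1 \<theta>"
    using infsum_Sigma'_banach[OF U'] le by (simp add: row_norm_def[abs_def] f_def)
qed

lemma sum_row_norm_le:
  assumes "\<theta> \<in> M1" "finite F"
  shows "(\<Sum>s\<in>F. row_norm \<theta> s) \<le> 2 * norm_M1 \<theta>"
  using finite_sum_le_infsum[OF row_norm_summable[OF assms(1)] assms(2)]
    infsum_row_norm_le[OF assms(1)] row_norm_nonneg[of \<theta>] by fastforce

lemma finite_ordered_pairs: "finite \<Lambda> \<Longrightarrow> finite (ordered_pairs \<Lambda>)"
  by (rule finite_subset[of _ "\<Lambda> \<times> \<Lambda>"]) (auto simp: ordered_pairs_def)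

lemma sum_ordered_pairs_le_norm_M1:
  assumes "\<theta> \<in> M1" "finite \<Lambda>"
  shows "(\<Sum>(s, l)\<in>ordered_pairs \<Lambda>. \<bar>\<theta> s l\<bar>) \<le> norm_M1 \<theta>"
  unfolding norm_M1_def using assms
  by (intro finite_sum_le_infsum finite_ordered_pairs) (auto simp: M1_def ordered_pairs_def)

section \<open>A countable dense set of matrices\<close>

text \<open>Lists of entries form a countable type when the index type is countable, so quantifiers
  over them can be moved through almost sure statements. The lookup at the sorted pair forces
  symmetry for every list, with no condition on its keys.\<close>

definition rational_matrix :: "(('s::linorder \<times> 's) \<times> rat) list \<Rightarrow> 's \<Rightarrow> 's \<Rightarrow> real"
  where "rational_matrix es s l =
    (case map_of es (min s l, max s l) of None \<Rightarrow> 0 | Some r \<Rightarrow> of_rat r)"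

lemma finite_support_rational_matrix:
  "finite {(s, l). rational_matrix es s l \<noteq> 0}"
proof (rule finite_subset)
  let ?F = "fst ` set es"
  show "{(s, l). rational_matrix es s l \<noteq> 0} \<subseteq> ?F \<union> prod.swap ` ?F"
  proof clarify
    fix s l assume nz: "rational_matrix es s l \<noteq> 0" and not_swap: "(s, l) \<notin> prod.swap ` ?F"
    have "(min s l, max s l) \<in> ?F"
      using nz by (auto simp: rational_matrix_def split: option.splits dest!: map_of_SomeD intro: rev_image_eqI)
    then show "(s, l) \<in> ?F"
      using not_swap by (cases "s \<le> l") (auto simp: min_def max_def image_iff)
  qed
qed auto

lemma rational_matrix_rows:
  "finite {s. \<exists>l. rational_matrix es s l \<noteq> 0}" "finite {l. rational_matrix es s l \<noteq> 0}"
proof -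
  have "{s. \<exists>l. rational_matrix es s l \<noteq> 0} = fst ` {(s, l). rational_matrix es s l \<noteq> 0}"
    by (auto simp: image_iff)
  then show "finite {s. \<exists>l. rational_matrix es s l \<noteq> 0}"
    using finite_support_rational_matrix[of es] by (simp only: finite_imageI)
  have "{l. rational_matrix es s l \<noteq> 0} \<subseteq> snd ` {(s, l). rational_matrix es s l \<noteq> 0}"
    by (auto simp: image_iff)
  then show "finite {l. rational_matrix es s l \<noteq> 0}"
    by (rule finite_subset) (intro finite_imageI finite_support_rational_matrix)
qed

lemma rational_matrix_M1: "rational_matrix es \<in> M1"
proof -
  have "(\<lambda>l. \<bar>rational_matrix es s l\<bar>) summable_on UNIV - {s}" for s
    using rational_matrix_rows(2)[of es s]
    by (intro finite_nonzero_values_imp_summable_on) (auto elim: rev_finite_subset)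
  moreover have "(\<lambda>(s, l). \<bar>rational_matrix es s l\<bar>) summable_on ordered_pairs UNIV"
    using finite_support_rational_matrix[of es]
    by (intro finite_nonzero_values_imp_summable_on) (auto elim!: rev_finite_subset)
  moreover have "rational_matrix es s l = rational_matrix es l s" for s l
    by (simp add: rational_matrix_def min.commute max.commute)
  ultimately show ?thesis by (auto simp: M1_def matrices_def)
qed

text \<open>Dropping the entries outside a finite set costs the tail of the norm, at most
  \<open>e / 3\<close>; rounding the finitely many kept entries to rationals costs at most another
  \<open>e / 3\<close>.\<close>

lemma rational_matrix_dense:
  assumes \<theta>: "\<theta> \<in> M1" and e: "e > 0"
  shows "\<exists>\<eta>\<in>range rational_matrix. dist_M1 \<theta> \<eta> < e"
proof -
  let ?P = "ordered_pairs (UNIV :: 'a set)"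
  define f where "f = (\<lambda>(s, l). \<bar>\<theta> s l\<bar>)"
  have sm: "f summable_on ?P" using \<theta> by (simp add: f_def M1_def)
  obtain F where F: "finite F" "F \<subseteq> ?P" "dist (sum f F) (infsum f ?P) \<le> e / 3"
    using infsum_finite_approximation[OF sm, of "e / 3"] e by auto
  \<comment> \<open>The error is shared among the entries of \<open>F\<close>; the added 1 covers an
    empty \<open>F\<close>.\<close>
  define d where "d = e / (3 * (real (card F) + 1))"
  have d: "d > 0" using e by (simp add: d_def)
  have "\<exists>r. \<bar>\<theta> (fst p) (snd p) - of_rat r\<bar> < d" for p
    proof -
    obtain r where "\<theta> (fst p) (snd p) - d < of_rat r" "of_rat r < \<theta> (fst p) (snd p) + d"
      using of_rat_dense[of "\<theta> (fst p) (snd p) - d" "\<theta> (fst p) (snd p) + d"] d by auto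
    then show ?thesis by (intro exI[of _ r]) (simp add: abs_less_iff)
  qed
  then obtain r where r: "\<And>p. \<bar>\<theta> (fst p) (snd p) - of_rat (r p)\<bar> < d" by metis
  obtain ps where ps: "set ps = F" using F(1) finite_list by blast
  define \<eta> where "\<eta> = rational_matrix (map (\<lambda>p. (p, r p)) ps)"
  have \<eta>: "\<eta> \<in> M1" by (simp add: \<eta>_def rational_matrix_M1)
  have \<eta>_eq: "\<eta> s l = (if (s, l) \<in> F then of_rat (r (s, l)) else 0)" if "s \<le> l" for s l
    using that ps by (simp add: \<eta>_def rational_matrix_def map_of_map_restrict restrict_map_def)
  define g where "g = (\<lambda>(s, l). \<bar>\<theta> s l - \<eta> s l\<bar>)"
  have g: "g summable_on ?P" unfolding g_def by (rule summable_diff_M1[OF \<theta> \<eta>])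
  have split_P: "F \<union> (?P - F) = ?P" using F(2) by auto
  have split: "infsum h ?P = sum h F + infsum h (?P - F)" if "h summable_on ?P" for h :: "_ \<Rightarrow> real"
    using infsum_Un_disjoint[of h F "?P - F"] F(1) split_P
      summable_on_subset_banach[OF that, of "?P - F"] by auto
  have "dist_M1 \<theta> \<eta> = infsum g ?P" by (simp add: dist_M1_def norm_M1_def g_def)
  also have "\<dots> = sum g F + infsum g (?P - F)" by (rule split[OF g])
  \<comment> \<open>Outside \<open>F\<close> the approximant vanishes on ordered pairs, so the
    distance there is the tail of \<open>\<theta>\<close> itself.\<close>
  also have "infsum g (?P - F) = infsum f (?P - F)"
    by (rule infsum_cong) (auto simp: g_def f_def \<eta>_eq ordered_pairs_def)
  also have "\<dots> = infsum f ?P - sum f F" using split[OF sm] by simp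
  also have "\<dots> \<le> e / 3" using F(3) unfolding dist_real_def by linarith
  also have "sum g F \<le> (\<Sum>p\<in>F. d)"
  proof (rule sum_mono)
    fix p assume p: "p \<in> F"
    obtain s l where sl: "p = (s, l)" by fastforce
    with p F(2) have "s \<le> l" by (auto simp: ordered_pairs_def)
    then have "\<eta> s l = of_rat (r p)" using p sl \<eta>_eq[of s l] by simp
    then show "g p \<le> d"
      using r[of p] sl by (simp add: g_def)
  qed
  also have "\<dots> \<le> (real (card F) + 1) * d" using d by (simp add: algebra_simps)
  also have "\<dots> = e / 3"
  proof -
    have "real (card F) + 1 \<noteq> 0" by linarith
    then show ?thesis by (simp add: d_def divide_simps)
  qed
  finally have "dist_M1 \<theta> \<eta> < e" using e by simp
  then show ?thesis unfolding \<eta>_def by blast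
qed

section \<open>Auxiliary facts on infinite sums\<close>

text \<open>The sum is an integral against counting measure on a countable set, and parameter
  integrals are measurable. Real summability is absolute, which lets the two notions of sum be
  identified.\<close>

lemma borel_measurable_infsum:
  fixes f :: "'i \<Rightarrow> 'b \<Rightarrow> real"
  assumes A: "countable A" and f: "\<And>l. l \<in> A \<Longrightarrow> f l \<in> borel_measurable M"
    and summable: "\<And>x. x \<in> space M \<Longrightarrow> (\<lambda>l. f l x) summable_on A"
  shows "(\<lambda>x. \<Sum>\<^sub>\<infinity>l\<in>A. f l x) \<in> borel_measurable M"
proof -
  interpret sigma_finite_measure "count_space A"
    by (rule sigma_finite_measure_count_space_countable[OF A])
  have "(\<lambda>x. f (snd x) (fst x)) \<in> borel_measurable (M \<Otimes>\<^sub>M count_space A)"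
    by (subst measurable_pair_swap_iff, rule measurable_pair_measure_countable1[OF A]) (use f in auto)
  then have "(\<lambda>x. \<integral>l. f l x \<partial>count_space A) \<in> borel_measurable M"
    by (intro borel_measurable_lebesgue_integral) (simp add: case_prod_unfold)
  moreover have "(\<integral>l. f l x \<partial>count_space A) = (\<Sum>\<^sub>\<infinity>l\<in>A. f l x)" if "x \<in> space M" for x
  proof -
    have "(\<lambda>l. norm (f l x)) summable_on A"
      by (rule summable_on_iff_abs_summable_on_real[THEN iffD1, OF summable[OF that]])
    then have "Infinite_Set_Sum.abs_summable_on (\<lambda>l. f l x) A"
      by (simp only: abs_summable_equivalent)
    then show ?thesis by (simp only: infsetsum_infsum[symmetric] infsetsum_def)
  qed
  ultimately show ?thesis
    by (subst measurable_cong[of M _ "\<lambda>x. \<integral>l. f l x \<partial>count_space A"]) simp_all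
qed

lemma has_sum_ereal:
  assumes "(f has_sum S) A"
  shows "((\<lambda>x. ereal (f x)) has_sum ereal S) A"
proof -
  have "sum (\<lambda>x. ereal (f x)) = (\<lambda>F. ereal (sum f F))" by (simp add: fun_eq_iff)
  then show ?thesis using assms by (simp add: has_sum_def)
qed

lemma M1_matrices: "\<theta> \<in> M1 \<Longrightarrow> \<theta> \<in> matrices"
  by (simp add: M1_def)

lemma row_norm_madd_diff:
  "row_norm (\<lambda>s l. madd \<zeta> \<theta> s l - madd \<zeta> \<eta> s l) s = row_norm (\<lambda>s l. \<theta> s l - \<eta> s l) s"
  by (simp add: row_norm_def madd_def)

lemma row_norm_mono:
  assumes "row_summable \<eta> s" "\<And>l. \<bar>\<theta> s l\<bar> \<le> \<bar>\<eta> s l\<bar>"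
  shows "row_norm \<theta> s \<le> row_norm \<eta> s"
proof -
  have \<eta>: "(\<lambda>l. \<bar>\<eta> s l\<bar>) summable_on UNIV"
    using assms(1) by (simp only: row_summable_def)
  have "(\<lambda>l. \<bar>\<theta> s l\<bar>) summable_on UNIV"
    by (rule summable_on_comparison_test[OF \<eta>]) (use assms(2) in simp_all)
  then show ?thesis
    unfolding row_norm_def by (rule infsum_mono[OF _ \<eta> assms(2)])
qed

section \<open>Finite windows as truncated rows\<close>

text \<open>Setting the entries outside the window to zero turns a windowed density into a full one,
  so that bounds need proof only for \<open>UNIV\<close>. The diagonal is kept by
  \<open>insert s\<close>, because its term is present in the energy for every window.\<close>

definition row_restrict :: "'s set \<Rightarrow> ('s \<Rightarrow> 's \<Rightarrow> real) \<Rightarrow> 's \<Rightarrow> 's \<Rightarrow> real"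
  where "row_restrict \<Lambda> \<theta> s l = (if l \<in> insert s \<Lambda> then \<theta> s l else 0)"

lemma row_summable_restrict:
  assumes "row_summable \<theta> s"
  shows "row_summable (row_restrict \<Lambda> \<theta>) s"
  using assms unfolding row_summable_def
  by (rule summable_on_comparison_test) (auto simp: row_restrict_def)

lemma cond_density_row_restrict:
  "cond_density \<rho> A B0 B \<Lambda> \<theta> s u x = cond_density \<rho> A B0 B UNIV (row_restrict \<Lambda> \<theta>) s u x"
proof -
  have "cond_energy A B0 B \<Lambda> \<theta> s v x = cond_energy A B0 B UNIV (row_restrict \<Lambda> \<theta>) s v x" for v
  proof -
    have "(\<Sum>\<^sub>\<infinity>l\<in>\<Lambda> - {s}. \<theta> s l * B v (x l)) = (\<Sum>\<^sub>\<infinity>l\<in>UNIV - {s}. row_restrict \<Lambda> \<theta> s l * B v (x l))"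
      by (rule infsum_cong_neutral) (auto simp: row_restrict_def)
    then show ?thesis by (simp add: cond_energy_def row_restrict_def)
  qed
  then show ?thesis by (simp add: cond_density_def)
qed

text \<open>The density at \<open>s\<close> reads only row \<open>s\<close>. Hence sites whose row
  is unperturbed drop out of the log ratios, and truncation may be compared row by row.\<close>

lemma cond_density_cong_row:
  assumes "\<theta> s = \<eta> s"
  shows "cond_density \<rho> A B0 B \<Lambda> \<theta> s u x = cond_density \<rho> A B0 B \<Lambda> \<eta> s u x"
  using assms by (simp add: cond_density_def cond_energy_def)

lemma cond_density_finite_range:
  assumes "{l. l \<noteq> s \<and> \<theta> s l \<noteq> 0} \<subseteq> \<Lambda>"
  shows "cond_density \<rho> A B0 B \<Lambda> \<theta> s u x = cond_density \<rho> A B0 B UNIV \<theta> s u x"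
proof -
  have "row_restrict \<Lambda> \<theta> s = \<theta> s" using assms by (auto simp: row_restrict_def fun_eq_iff)
  then show ?thesis
    by (subst cond_density_row_restrict) (rule cond_density_cong_row)
qed

lemma incseq_finite_subset:
  assumes "incseq D" "(\<Union>n. D n) = UNIV" "finite T"
  shows "\<forall>\<^sub>F n in sequentially. T \<subseteq> D n"
proof -
  have "\<forall>\<^sub>F n in sequentially. t \<in> D n" for t
  proof -
    obtain m where "t \<in> D m" using assms(2) by blast
    then have "t \<in> D n" if "n \<ge> m" for n using incseqD[OF assms(1) that] by blast
    then show ?thesis by (auto simp: eventually_sequentially)
  qed
  then have "\<forall>\<^sub>F n in sequentially. \<forall>t\<in>T. t \<in> D n"
    by (intro eventually_ball_finite assms(3)) auto
  then show ?thesis by (simp add: subset_iff Ball_def)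
qed

lemma abs_infsum_diff_le:
  fixes f g h :: "'i \<Rightarrow> real"
  assumes "f summable_on A" "g summable_on A" "h summable_on A" "\<And>i. i \<in> A \<Longrightarrow> \<bar>f i - g i\<bar> \<le> h i"
  shows "\<bar>infsum f A - infsum g A\<bar> \<le> infsum h A"
proof -
  have "infsum f A \<le> infsum (\<lambda>i. g i + h i) A" "infsum g A \<le> infsum (\<lambda>i. f i + h i) A"
    using assms by (intro infsum_mono summable_on_add; force simp: abs_le_iff)+
  then show ?thesis
    using assms by (simp add: infsum_add abs_le_iff)
qed

lemma integrable_pair_bounded:
  fixes f :: "'b \<times> 'c \<Rightarrow> real"
  assumes "finite_measure M" "finite_measure N" "f \<in> borel_measurable (M \<Otimes>\<^sub>M N)"
    and "\<And>z. z \<in> space (M \<Otimes>\<^sub>M N) \<Longrightarrow> \<bar>f z\<bar> \<le> K"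
  shows "integrable (M \<Otimes>\<^sub>M N) f"
proof -
  interpret pair: finite_measure "M \<Otimes>\<^sub>M N"
    by (intro finite_measure_pair_measure assms)
  show ?thesis
    using assms(3,4) by (intro pair.integrable_const_bound[where B = K] AE_I2) auto
qed

section \<open>Conditional densities of bounded interactions\<close>

locale bounded_interaction =
  fixes \<rho> :: "'a measure" and A B0 :: "'a \<Rightarrow> real" and B :: "'a \<Rightarrow> 'a \<Rightarrow> real" and C :: real
  assumes finite_measure_rho: "finite_measure \<rho>"
    and nonnull: "emeasure \<rho> (space \<rho>) \<noteq> 0"
    and measurable_A [measurable]: "A \<in> borel_measurable \<rho>"
    and measurable_B0 [measurable]: "B0 \<in> borel_measurable \<rho>"
    and measurable_B: "(\<lambda>(x, y). B x y) \<in> borel_measurable (\<rho> \<Otimes>\<^sub>M \<rho>)"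
    and A_bound: "\<And>u. u \<in> space \<rho> \<Longrightarrow> \<bar>A u\<bar> \<le> C"
    and B0_bound: "\<And>u. u \<in> space \<rho> \<Longrightarrow> \<bar>B0 u\<bar> \<le> C"
    and B_bound: "\<And>u v. u \<in> space \<rho> \<Longrightarrow> v \<in> space \<rho> \<Longrightarrow> \<bar>B u v\<bar> \<le> C"
begin

sublocale finite_measure \<rho> by (rule finite_measure_rho)

text \<open>A measure of nonzero total mass has a point in its space, and there \<open>C\<close>
  bounds an absolute value.\<close>

lemma C_nonneg: "C \<ge> 0"
  using nonnull A_bound by (metis abs_ge_zero all_not_in_conv emeasure_empty order.trans)

abbreviation "configs \<equiv> Pi\<^sub>M UNIV (\<lambda>_. \<rho>)"

abbreviation "energy \<equiv> cond_energy A B0 B UNIV"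

abbreviation "cdens \<equiv> cond_density \<rho> A B0 B UNIV"

section \<open>Normalizing constants and log densities\<close>

lemma integrable_exp_bounded:
  fixes e :: "'a \<Rightarrow> real"
  assumes [measurable]: "e \<in> borel_measurable \<rho>" and "\<And>v. v \<in> space \<rho> \<Longrightarrow> \<bar>e v\<bar> \<le> c"
  shows "integrable \<rho> (\<lambda>v. exp (e v))"
  using assms(2) by (intro integrable_const_bound[where B = "exp c"]) (force intro!: AE_I2)+

lemma integral_exp_bounds:
  fixes e :: "'a \<Rightarrow> real"
  assumes [measurable]: "e \<in> borel_measurable \<rho>" and bound: "\<And>v. v \<in> space \<rho> \<Longrightarrow> \<bar>e v\<bar> \<le> c"
  shows "(\<integral>v. exp (e v) \<partial>\<rho>) \<ge> exp (- c) * measure \<rho> (space \<rho>)" "(\<integral>v. exp (e v) \<partial>\<rho>) > 0"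
proof -
  have "(\<integral>v. exp (- c) \<partial>\<rho>) \<le> (\<integral>v. exp (e v) \<partial>\<rho>)"
    using bound by (intro integral_mono integrable_exp_bounded[OF assms]) force+
  then show *: "(\<integral>v. exp (e v) \<partial>\<rho>) \<ge> exp (- c) * measure \<rho> (space \<rho>)"
    by (simp add: mult.commute)
  have "measure \<rho> (space \<rho>) > 0"
    using nonnull by (simp add: emeasure_eq_measure zero_less_measure_iff)
  then have "exp (- c) * measure \<rho> (space \<rho>) > 0" by simp
  with * show "(\<integral>v. exp (e v) \<partial>\<rho>) > 0" by linarith
qed

text \<open>One \<open>d\<close> comes from the energies at \<open>u\<close>. The other comes from
  the normalizing constants: integrating \<open>exp f \<le> exp d * exp g\<close> shifts their
  logarithms by at most \<open>d\<close>, and the argument is symmetric in the two energies.\<close>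

lemma log_density_diff_le:
  fixes e e' :: "'a \<Rightarrow> real"
  assumes meas: "e \<in> borel_measurable \<rho>" "e' \<in> borel_measurable \<rho>"
    and bound: "\<And>v. v \<in> space \<rho> \<Longrightarrow> \<bar>e v\<bar> \<le> c" "\<And>v. v \<in> space \<rho> \<Longrightarrow> \<bar>e' v\<bar> \<le> c'"
    and diff: "\<And>v. v \<in> space \<rho> \<Longrightarrow> \<bar>e v - e' v\<bar> \<le> d"
    and u: "u \<in> space \<rho>"
  shows "\<bar>ln (exp (e u) / (\<integral>v. exp (e v) \<partial>\<rho>)) - ln (exp (e' u) / (\<integral>v. exp (e' v) \<partial>\<rho>))\<bar> \<le> 2 * d"
proof -
  have le: "ln (\<integral>v. exp (f v) \<partial>\<rho>) \<le> d + ln (\<integral>v. exp (g v) \<partial>\<rho>)"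
    if f: "f \<in> borel_measurable \<rho>" "\<And>v. v \<in> space \<rho> \<Longrightarrow> \<bar>f v\<bar> \<le> a"
      and g: "g \<in> borel_measurable \<rho>" "\<And>v. v \<in> space \<rho> \<Longrightarrow> \<bar>g v\<bar> \<le> b"
      and fg: "\<And>v. v \<in> space \<rho> \<Longrightarrow> \<bar>f v - g v\<bar> \<le> d" for f g a b
  proof -
    have "(\<integral>v. exp (f v) \<partial>\<rho>) \<le> (\<integral>v. exp d * exp (g v) \<partial>\<rho>)"
    proof (rule integral_mono)
      show "exp (f v) \<le> exp d * exp (g v)" if "v \<in> space \<rho>" for v
        using fg[OF that] by (simp flip: exp_add)
    qed (simp_all add: integrable_exp_bounded[OF f] integrable_exp_bounded[OF g])
    then have "ln (\<integral>v. exp (f v) \<partial>\<rho>) \<le> ln (exp d * (\<integral>v. exp (g v) \<partial>\<rho>))"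
      using integral_exp_bounds(2)[OF f] by simp
    then show ?thesis using integral_exp_bounds(2)[OF g] by (simp add: ln_mult)
  qed
  have "ln (exp (e u) / (\<integral>v. exp (e v) \<partial>\<rho>)) = e u - ln (\<integral>v. exp (e v) \<partial>\<rho>)"
    "ln (exp (e' u) / (\<integral>v. exp (e' v) \<partial>\<rho>)) = e' u - ln (\<integral>v. exp (e' v) \<partial>\<rho>)"
    using integral_exp_bounds(2)[OF meas(1) bound(1)] integral_exp_bounds(2)[OF meas(2) bound(2)]
    by (simp_all add: ln_div)
  moreover have "ln (\<integral>v. exp (e v) \<partial>\<rho>) \<le> d + ln (\<integral>v. exp (e' v) \<partial>\<rho>)"
    by (rule le[OF meas(1) bound(1) meas(2) bound(2) diff])
  moreover have "ln (\<integral>v. exp (e' v) \<partial>\<rho>) \<le> d + ln (\<integral>v. exp (e v) \<partial>\<rho>)"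
    by (rule le[OF meas(2) bound(2) meas(1) bound(1)]) (assumption | subst abs_minus_commute, rule diff)+
  ultimately show ?thesis using diff[OF u] by simp
qed

section \<open>Energies as row sums\<close>

text \<open>This folds the diagonal term into the row sum. The case \<open>l = s\<close> must be
  separate, as \<open>B u (x s)\<close> would involve the old value of the coordinate being
  described by \<open>u\<close>.\<close>

definition site_interaction :: "'s \<Rightarrow> 'a \<Rightarrow> ('s \<Rightarrow> 'a) \<Rightarrow> 's \<Rightarrow> real"
  where "site_interaction s u x l = (if l = s then B0 u else B u (x l))"

lemma config_apply: "x \<in> space configs \<Longrightarrow> x l \<in> space \<rho>"
  by (auto simp: space_PiM)

lemma site_interaction_bound:
  assumes "u \<in> space \<rho>" "x \<in> space configs"
  shows "\<bar>site_interaction s u x l\<bar> \<le> C"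
  using B0_bound[OF assms(1)] B_bound[OF assms(1) config_apply[OF assms(2)]]
  by (simp add: site_interaction_def)

lemma site_interaction_abs_summable:
  assumes "row_summable \<theta> s" "u \<in> space \<rho>" "x \<in> space configs"
  shows "(\<lambda>l. \<bar>\<theta> s l * site_interaction s u x l\<bar>) summable_on L"
proof (rule summable_on_comparison_test)
  show "(\<lambda>l. C * \<bar>\<theta> s l\<bar>) summable_on L"
    using assms(1) unfolding row_summable_def by (intro summable_on_cmult_right) (auto intro: summable_on_subset_banach)
  show "\<bar>\<theta> s l * site_interaction s u x l\<bar> \<le> C * \<bar>\<theta> s l\<bar>" for l
    using site_interaction_bound[OF assms(2,3), of s l]
    by (simp add: abs_mult mult.commute[of C] mult_left_mono)
qed auto

lemma site_interaction_summable:
  assumes "row_summable \<theta> s" "u \<in> space \<rho>" "x \<in> space configs"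
  shows "(\<lambda>l. \<theta> s l * site_interaction s u x l) summable_on L"
  by (rule summable_on_iff_abs_summable_on_real[THEN iffD2])
     (use site_interaction_abs_summable[of \<theta>, OF assms, of L] in simp)

lemma energy_eq:
  assumes "row_summable \<theta> s" "u \<in> space \<rho>" "x \<in> space configs"
  shows "energy \<theta> s u x = A u + (\<Sum>\<^sub>\<infinity>l. \<theta> s l * site_interaction s u x l)"
proof -
  have "(\<Sum>\<^sub>\<infinity>l\<in>insert s (UNIV - {s}). \<theta> s l * site_interaction s u x l) =
      \<theta> s s * B0 u + (\<Sum>\<^sub>\<infinity>l\<in>UNIV - {s}. \<theta> s l * site_interaction s u x l)"
    using site_interaction_summable[of \<theta>, OF assms, of "UNIV - {s}"]
    by (subst infsum_insert) (auto simp: site_interaction_def)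
  also have "(\<Sum>\<^sub>\<infinity>l\<in>UNIV - {s}. \<theta> s l * site_interaction s u x l) = (\<Sum>\<^sub>\<infinity>l\<in>UNIV - {s}. \<theta> s l * B u (x l))"
    by (rule infsum_cong) (auto simp: site_interaction_def)
  finally show ?thesis by (simp add: cond_energy_def insert_UNIV)
qed

text \<open>The energy is affine in the row with constant part \<open>A\<close>, so \<open>A\<close>
  cancels and the difference is the row sum for \<open>\<theta> - \<eta>\<close>, each of whose
  factors is bounded by \<open>C\<close>.\<close>

lemma energy_diff_le:
  assumes \<theta>: "row_summable \<theta> s" and \<eta>: "row_summable \<eta> s"
    and ux: "u \<in> space \<rho>" "x \<in> space configs"
  shows "\<bar>energy \<theta> s u x - energy \<eta> s u x\<bar> \<le> C * row_norm (\<lambda>s l. \<theta> s l - \<eta> s l) s"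
proof -
  let ?\<zeta> = "\<lambda>s l. \<theta> s l - \<eta> s l"
  have \<zeta>: "row_summable ?\<zeta> s" by (rule row_summable_diff[OF \<theta> \<eta>])
  have "(\<Sum>\<^sub>\<infinity>l. ?\<zeta> s l * site_interaction s u x l) + (\<Sum>\<^sub>\<infinity>l. \<eta> s l * site_interaction s u x l)
      = (\<Sum>\<^sub>\<infinity>l. ?\<zeta> s l * site_interaction s u x l + \<eta> s l * site_interaction s u x l)"
    by (rule infsum_add[symmetric]) (intro site_interaction_summable[of ?\<zeta>] site_interaction_summable \<zeta> \<eta> ux)+
  then have "energy \<theta> s u x - energy \<eta> s u x = (\<Sum>\<^sub>\<infinity>l. ?\<zeta> s l * site_interaction s u x l)"
    by (simp add: energy_eq[OF \<theta> ux] energy_eq[OF \<eta> ux] algebra_simps)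
  also have "\<bar>\<dots>\<bar> \<le> (\<Sum>\<^sub>\<infinity>l. C * \<bar>?\<zeta> s l\<bar>)"
  proof (rule order.trans)
    show "\<bar>\<Sum>\<^sub>\<infinity>l. ?\<zeta> s l * site_interaction s u x l\<bar> \<le> (\<Sum>\<^sub>\<infinity>l. \<bar>?\<zeta> s l * site_interaction s u x l\<bar>)"
      using norm_infsum_bound[of "\<lambda>l. ?\<zeta> s l * site_interaction s u x l" UNIV]
        site_interaction_abs_summable[of ?\<zeta>, OF \<zeta> ux] by simp
    show "(\<Sum>\<^sub>\<infinity>l. \<bar>?\<zeta> s l * site_interaction s u x l\<bar>) \<le> (\<Sum>\<^sub>\<infinity>l. C * \<bar>?\<zeta> s l\<bar>)"
    proof (rule infsum_mono)
      show "(\<lambda>l. \<bar>?\<zeta> s l * site_interaction s u x l\<bar>) summable_on UNIV"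
        by (rule site_interaction_abs_summable[of ?\<zeta>, OF \<zeta> ux])
      show "\<bar>?\<zeta> s l * site_interaction s u x l\<bar> \<le> C * \<bar>?\<zeta> s l\<bar>" for l
        using site_interaction_bound[OF ux, of s l] by (simp add: abs_mult mult.commute[of C] mult_left_mono)
    qed (use \<zeta> in \<open>auto simp: row_summable_def intro: summable_on_cmult_right\<close>)
  qed
  also have "\<dots> = C * row_norm ?\<zeta> s"
    unfolding row_norm_def by (rule infsum_cmult_right')
  finally show ?thesis .
qed

lemma energy_bound:
  assumes \<theta>: "row_summable \<theta> s" and ux: "u \<in> space \<rho>" "x \<in> space configs"
  shows "\<bar>energy \<theta> s u x\<bar> \<le> C + C * row_norm \<theta> s"
proof -
  have "energy (\<lambda>_ _. 0) s u x = A u"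
    by (simp add: cond_energy_def)
  then show ?thesis
    using energy_diff_le[of \<theta> s "\<lambda>_ _. 0" u x] \<theta> ux A_bound[OF ux(1)] by simp
qed

text \<open>Measurable arguments \<open>f\<close> and \<open>g\<close> cover the three uses at once:
  a fixed configuration, a point of a product space, and a configuration evaluated at its own
  coordinate \<open>x s\<close>.\<close>

lemma measurable_energy [measurable (raw)]:
  fixes \<theta> :: "'s::countable \<Rightarrow> 's \<Rightarrow> real"
  assumes \<theta>: "row_summable \<theta> s"
    and [measurable]: "f \<in> M \<rightarrow>\<^sub>M \<rho>" "g \<in> M \<rightarrow>\<^sub>M configs"
  shows "(\<lambda>y. energy \<theta> s (f y) (g y)) \<in> borel_measurable M"
proof -
  have [measurable]: "(\<lambda>y. B (f y) (g y l)) \<in> borel_measurable M" for l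
    using measurable_compose[OF _ measurable_B, of "\<lambda>y. (f y, g y l)" M] by simp
  have "(\<lambda>y. A (f y) + (\<Sum>\<^sub>\<infinity>l. \<theta> s l * site_interaction s (f y) (g y) l)) \<in> borel_measurable M"
    by (intro borel_measurable_add borel_measurable_infsum site_interaction_summable \<theta>)
       (auto simp: site_interaction_def intro: measurable_space[OF assms(2)] measurable_space[OF assms(3)])
  then show ?thesis
    by (rule measurable_cong[THEN iffD1, rotated])
       (simp add: energy_eq[of \<theta>, OF \<theta>] measurable_space[OF assms(2)] measurable_space[OF assms(3)])
qed

lemma measurable_energy_site:
  fixes \<theta> :: "'s::countable \<Rightarrow> 's \<Rightarrow> real"
  assumes "row_summable \<theta> s" "x \<in> space configs"
  shows "(\<lambda>u. energy \<theta> s u x) \<in> borel_measurable \<rho>"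
  using assms by (intro measurable_energy) auto

lemma log_cdens_diff_le:
  fixes \<theta> \<eta> :: "'s::countable \<Rightarrow> 's \<Rightarrow> real"
  assumes \<theta>: "row_summable \<theta> s" and \<eta>: "row_summable \<eta> s"
    and ux: "u \<in> space \<rho>" "x \<in> space configs"
  shows "\<bar>ln (cdens \<theta> s u x) - ln (cdens \<eta> s u x)\<bar> \<le> 2 * (C * row_norm (\<lambda>s l. \<theta> s l - \<eta> s l) s)"
  unfolding cond_density_def
  by (rule log_density_diff_le[OF measurable_energy_site[OF \<theta> ux(2)] measurable_energy_site[OF \<eta> ux(2)]
        energy_bound[OF \<theta> _ ux(2)] energy_bound[OF \<eta> _ ux(2)] energy_diff_le[OF \<theta> \<eta> _ ux(2)] ux(1)])

lemma cdens_pos: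
  fixes \<theta> :: "'s::countable \<Rightarrow> 's \<Rightarrow> real"
  assumes \<theta>: "row_summable \<theta> s" and x: "x \<in> space configs"
  shows "cdens \<theta> s u x > 0"
  unfolding cond_density_def
  using integral_exp_bounds(2)[OF measurable_energy_site[OF \<theta> x] energy_bound[OF \<theta> _ x]]
  by simp

lemma integrable_cdens:
  fixes \<theta> :: "'s::countable \<Rightarrow> 's \<Rightarrow> real"
  assumes \<theta>: "row_summable \<theta> s" and x: "x \<in> space configs"
  shows "integrable \<rho> (\<lambda>u. cdens \<theta> s u x)"
  unfolding cond_density_def
  using integrable_exp_bounded[OF measurable_energy_site[OF \<theta> x] energy_bound[OF \<theta> _ x]]
  by (intro integrable_divide)

lemma measurable_cdens [measurable (raw)]:
  fixes \<theta> :: "'s::countable \<Rightarrow> 's \<Rightarrow> real"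
  assumes \<theta>: "row_summable \<theta> s"
    and [measurable]: "f \<in> M \<rightarrow>\<^sub>M \<rho>" "g \<in> M \<rightarrow>\<^sub>M configs"
  shows "(\<lambda>y. cdens \<theta> s (f y) (g y)) \<in> borel_measurable M"
proof -
  note [measurable (raw)] = measurable_energy[of \<theta>, OF \<theta>]
  have "(\<lambda>y. \<integral>v. exp (energy \<theta> s v (g y)) \<partial>\<rho>) \<in> borel_measurable M"
    by (rule borel_measurable_lebesgue_integral) measurable
  then show ?thesis
    unfolding cond_density_def by measurable
qed

text \<open>Comparison with the zero matrix, whose density depends on \<open>A\<close> alone, gives
  a bound uniform in \<open>u\<close> and \<open>x\<close>.\<close>

lemma log_cdens_bounded:
  fixes \<theta> :: "'s::countable \<Rightarrow> 's \<Rightarrow> real"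
  assumes \<theta>: "row_summable \<theta> s"
  obtains K where "\<And>u x. u \<in> space \<rho> \<Longrightarrow> x \<in> space configs \<Longrightarrow> \<bar>ln (cdens \<theta> s u x)\<bar> \<le> K"
proof
  fix u and x :: "'s \<Rightarrow> 'a" assume ux: "u \<in> space \<rho>" "x \<in> space configs"
  have "\<bar>ln (cdens \<theta> s u x) - ln (cdens (\<lambda>_ _. 0) s u x)\<bar> \<le> 2 * (C * row_norm \<theta> s)"
    using log_cdens_diff_le[of \<theta> s "\<lambda>_ _. 0", OF \<theta> _ ux] by simp
  moreover have "ln (cdens (\<lambda>_ _. 0) s u x) = A u - ln (\<integral>v. exp (A v) \<partial>\<rho>)"
    using integral_exp_bounds(2)[OF measurable_A A_bound] by (simp add: cond_density_def cond_energy_def ln_div)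
  moreover have "\<bar>A u\<bar> \<le> C" by (rule A_bound[OF ux(1)])
  ultimately show "\<bar>ln (cdens \<theta> s u x)\<bar> \<le> 2 * (C * row_norm \<theta> s) + C + \<bar>ln (\<integral>v. exp (A v) \<partial>\<rho>)\<bar>"
    by linarith
qed

text \<open>The interaction sum omits \<open>l = s\<close>. This is why a resampled coordinate
  \<open>u\<close> enters the log ratio only as the point of evaluation.\<close>

lemma cdens_fun_upd: "cdens \<theta> s u (x(s := v)) = cdens \<theta> s u x"
proof -
  have "energy \<theta> s w (x(s := v)) = energy \<theta> s w x" for w
  proof -
    have "(\<Sum>\<^sub>\<infinity>l\<in>UNIV - {s}. \<theta> s l * B w ((x(s := v)) l)) = (\<Sum>\<^sub>\<infinity>l\<in>UNIV - {s}. \<theta> s l * B w (x l))"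
      by (rule infsum_cong) simp
    then show ?thesis by (simp only: cond_energy_def)
  qed
  then show ?thesis by (simp add: cond_density_def)
qed

subsection \<open>Resampling a coordinate\<close>

lemma subalgebra_others:
  assumes "sets \<mu> = sets (configs :: ('s \<Rightarrow> 'a) measure)"
  shows "subalgebra \<mu> (others_algebra \<rho> s)"
proof -
  have sp: "space \<mu> = space configs" using assms by (rule sets_eq_imp_space_eq)
  have "sets (others_algebra \<rho> s) \<subseteq> sets configs"
    unfolding others_algebra_def by (rule sets_image_in_sets) auto
  then show ?thesis
    using assms sp by (simp add: subalgebra_def others_algebra_def)
qed

lemma measurable_others:
  assumes "l \<noteq> s"
  shows "(\<lambda>x. x l) \<in> others_algebra \<rho> s \<rightarrow>\<^sub>M \<rho>"
proof -
  have "(\<lambda>x. restrict x (UNIV - {s})) \<in> others_algebra \<rho> s \<rightarrow>\<^sub>M Pi\<^sub>M (UNIV - {s}) (\<lambda>_. \<rho>)"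
    unfolding others_algebra_def by (rule measurable_vimage_algebra1) (auto simp: space_PiM PiE_iff)
  from measurable_compose[OF this measurable_component_singleton[of l]] assms
  have "(\<lambda>x. restrict x (UNIV - {s}) l) \<in> others_algebra \<rho> s \<rightarrow>\<^sub>M \<rho>"
    by (simp only: Diff_iff UNIV_I singleton_iff simp_thms)
  moreover have "(\<lambda>x :: _ \<Rightarrow> 'a. restrict x (UNIV - {s}) l) = (\<lambda>x. x l)"
    using assms by (simp add: restrict_def)
  ultimately show ?thesis by (simp only:)
qed

text \<open>The condition on the coordinates in \<open>J\<close> is an event of the other
  coordinates, so its indicator is an admissible test function for the conditional expectation of
  the event that coordinate \<open>s\<close> lies in \<open>E\<close>.\<close>

lemma full_conditionals_cylinder:
  fixes \<theta> :: "'s::countable \<Rightarrow> 's \<Rightarrow> real"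
  assumes fc: "has_full_conditionals \<rho> A B0 B \<theta> \<mu>"
    and \<theta>: "row_summable \<theta> s"
    and J: "finite J" "\<And>l. l \<in> J \<Longrightarrow> l \<noteq> s" "\<And>l. l \<in> J \<Longrightarrow> F l \<in> sets \<rho>" and E: "E \<in> sets \<rho>"
  shows "emeasure \<mu> {x \<in> space configs. x s \<in> E \<and> (\<forall>l\<in>J. x l \<in> F l)} =
    (\<integral>\<^sup>+x. \<integral>\<^sup>+u. ennreal (cdens \<theta> s u x) * indicator E u *
      indicator {x \<in> space configs. \<forall>l\<in>J. x l \<in> F l} x \<partial>\<rho> \<partial>\<mu>)"
proof -
  interpret \<mu>: prob_space \<mu> using fc by (simp add: has_full_conditionals_def)
  have sets_\<mu> [measurable_cong]: "sets \<mu> = sets configs" using fc by (simp add: has_full_conditionals_def)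
  have sp: "space \<mu> = space configs" using sets_\<mu> by (rule sets_eq_imp_space_eq)
  have sub: "subalgebra \<mu> (others_algebra \<rho> s)" by (rule subalgebra_others[OF sets_\<mu>])
  interpret sub: finite_measure_subalgebra \<mu> "others_algebra \<rho> s"
    by unfold_locales (rule sub)
  note [measurable] = E
  note [measurable (raw)] = measurable_cdens[of \<theta>, OF \<theta>]
  define G where "G = {x \<in> space configs. \<forall>l\<in>J. x l \<in> F l}"
  have "space (others_algebra \<rho> s) = space configs" by (simp add: others_algebra_def)
  moreover have "{x \<in> space (others_algebra \<rho> s). \<forall>l\<in>J. x l \<in> F l} \<in> sets (others_algebra \<rho> s)"
  proof (rule sets.sets_Collect_finite_All[OF _ J(1)])
    fix l assume l: "l \<in> J"
    have "(\<lambda>x. x l) -` F l \<inter> space (others_algebra \<rho> s) \<in> sets (others_algebra \<rho> s)"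
      by (rule measurable_sets[OF measurable_others[OF J(2)[OF l]] J(3)[OF l]])
    also have "(\<lambda>x. x l) -` F l \<inter> space (others_algebra \<rho> s) = {x \<in> space (others_algebra \<rho> s). x l \<in> F l}"
      by auto
    finally show "{x \<in> space (others_algebra \<rho> s). x l \<in> F l} \<in> sets (others_algebra \<rho> s)" .
  qed
  ultimately have G: "G \<in> sets (others_algebra \<rho> s)" by (simp add: G_def)
  then have G_\<mu> [measurable]: "G \<in> sets \<mu>" using sub by (auto simp: subalgebra_def)
  \<comment> \<open>The conditional probability appears as a real set integral in the hypothesis,
    whereas measures need nonnegative integrals; \<open>c_eq\<close> and \<open>c_nonneg\<close>
    mediate.\<close>
  define c where "c x = (LINT u:E|\<rho>. cdens \<theta> s u x)" for x
  have int_c: "integrable \<rho> (\<lambda>u. indicator E u * cdens \<theta> s u x)" if "x \<in> space configs" for x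
    using integrable_mult_indicator[OF E integrable_cdens[OF \<theta> that]] by simp
  have c_eq: "(\<integral>\<^sup>+u. ennreal (cdens \<theta> s u x) * indicator E u \<partial>\<rho>) = ennreal (c x)"
    and c_nonneg: "c x \<ge> 0" if x: "x \<in> space configs" for x
  proof -
    have nonneg: "indicator E u * cdens \<theta> s u x \<ge> 0" for u
      using cdens_pos[OF \<theta> x, of u] by (simp add: indicator_def)
    have "(\<integral>\<^sup>+u. ennreal (cdens \<theta> s u x) * indicator E u \<partial>\<rho>) =
        (\<integral>\<^sup>+u. ennreal (indicator E u * cdens \<theta> s u x) \<partial>\<rho>)"
      by (intro nn_integral_cong) (simp add: indicator_def)
    also have "\<dots> = ennreal (c x)"
      using nn_integral_eq_integral[OF int_c[OF x]] nonneg
      by (simp add: c_def set_lebesgue_integral_def)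
    finally show "(\<integral>\<^sup>+u. ennreal (cdens \<theta> s u x) * indicator E u \<partial>\<rho>) = ennreal (c x)" .
    show "c x \<ge> 0"
      using nonneg by (simp add: c_def set_lebesgue_integral_def)
  qed
  have rce: "AE x in \<mu>. real_cond_exp \<mu> (others_algebra \<rho> s) (\<lambda>y. indicator E (y s)) x = c x"
    using fc E by (auto simp: has_full_conditionals_def c_def)
  have int: "integrable \<mu> (\<lambda>x. indicator G x * indicator E (x s) :: real)"
    by (intro \<mu>.integrable_const_bound[where B = 1]) (auto split: split_indicator)
  have c_meas [measurable]: "c \<in> borel_measurable \<mu>"
    unfolding c_def[abs_def] set_lebesgue_integral_def
    by (rule borel_measurable_lebesgue_integral) measurable
  \<comment> \<open>The averaging property of conditional expectation with test function
    \<open>indicator G\<close>; the conditional expectation agrees with \<open>c\<close> almost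
    everywhere, which integrals over \<open>\<mu>\<close> do not notice.\<close>
  have rce_int: "integrable \<mu> (\<lambda>x. indicator G x * c x)" "(\<integral>x. indicator G x * c x \<partial>\<mu>) = (\<integral>x. indicator G x * indicator E (x s) \<partial>\<mu>)"
  proof -
    note ri = sub.real_cond_exp_intg[OF int]
    have mG: "indicator G \<in> borel_measurable (others_algebra \<rho> s)" using G by simp
    have mE: "(\<lambda>x. indicator E (x s) :: real) \<in> borel_measurable \<mu>" by measurable
    have rm: "(\<lambda>x. indicator G x * real_cond_exp \<mu> (others_algebra \<rho> s) (\<lambda>y. indicator E (y s)) x) \<in> borel_measurable \<mu>"
      by measurable
    show "integrable \<mu> (\<lambda>x. indicator G x * c x)"
      using ri(1)[OF mG mE]
      by (rule integrable_cong_AE_imp) (use rce in \<open>auto\<close>)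
    have "(\<integral>x. indicator G x * c x \<partial>\<mu>) =
        (\<integral>x. indicator G x * real_cond_exp \<mu> (others_algebra \<rho> s) (\<lambda>y. indicator E (y s)) x \<partial>\<mu>)"
      by (rule integral_cong_AE) (use rce rm in \<open>auto\<close>)
    then show "(\<integral>x. indicator G x * c x \<partial>\<mu>) = (\<integral>x. indicator G x * indicator E (x s) \<partial>\<mu>)"
      using ri(2)[OF mG mE] by simp
  qed
  have "(\<integral>\<^sup>+x. \<integral>\<^sup>+u. ennreal (cdens \<theta> s u x) * indicator E u * indicator G x \<partial>\<rho> \<partial>\<mu>)
      = (\<integral>\<^sup>+x. ennreal (indicator G x * c x) \<partial>\<mu>)"
    by (intro nn_integral_cong) (auto simp: sp c_eq split: split_indicator)
  also have "\<dots> = ennreal (\<integral>x. indicator G x * c x \<partial>\<mu>)"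
    using rce_int(1) c_nonneg by (intro nn_integral_eq_integral AE_I2) (auto simp: sp)
  also have "\<dots> = ennreal (\<integral>x. indicator {x \<in> space configs. x s \<in> E \<and> (\<forall>l\<in>J. x l \<in> F l)} x \<partial>\<mu>)"
    unfolding rce_int(2)
    by (intro arg_cong[of _ _ ennreal] Bochner_Integration.integral_cong) (auto simp: sp G_def split: split_indicator)
  also have "\<dots> = emeasure \<mu> {x \<in> space configs. x s \<in> E \<and> (\<forall>l\<in>J. x l \<in> F l)}"
  proof -
    have "{x \<in> space configs. x s \<in> E \<and> (\<forall>l\<in>J. x l \<in> F l)} = G \<inter> {x \<in> space \<mu>. x s \<in> E}"
      by (auto simp: G_def sp)
    also have "\<dots> \<in> sets \<mu>" by measurable
    finally show ?thesis by (simp add: \<mu>.emeasure_eq_measure)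
  qed
  finally show ?thesis by (simp add: G_def)
qed

text \<open>Both sides are measures on the product space and \<open>\<mu>\<close> is finite, so
  agreement on finite-dimensional cylinders decides; there the identity is the cylinder
  formula.\<close>

lemma full_conditionals_resample:
  fixes \<theta> :: "'s::countable \<Rightarrow> 's \<Rightarrow> real"
  assumes fc: "has_full_conditionals \<rho> A B0 B \<theta> \<mu>"
    and \<theta>: "row_summable \<theta> s"
  shows "\<mu> = distr (density (\<mu> \<Otimes>\<^sub>M \<rho>) (\<lambda>(x, u). ennreal (cdens \<theta> s u x))) configs (\<lambda>(x, u). x(s := u))"
    (is "_ = ?\<nu>")
proof (rule measure_eqI_PiM_infinite[where I = UNIV and M = "\<lambda>_. \<rho>"])
  interpret \<mu>: prob_space \<mu> using fc by (simp add: has_full_conditionals_def)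
  show sets_\<mu> [measurable_cong]: "sets \<mu> = sets configs" using fc by (simp add: has_full_conditionals_def)
  have sp: "space \<mu> = space configs" using sets_\<mu> by (rule sets_eq_imp_space_eq)
  show "finite_measure \<mu>" by unfold_locales
  note [measurable (raw)] = measurable_cdens[of \<theta>, OF \<theta>]
  have upd [measurable]: "(\<lambda>(x, u). x(s := u)) \<in> \<mu> \<Otimes>\<^sub>M \<rho> \<rightarrow>\<^sub>M configs"
    using measurable_add_dim[of s UNIV "\<lambda>_. \<rho>"] by (simp add: insert_UNIV cong: measurable_cong_sets)
  fix F J assume J: "finite J" "J \<subseteq> (UNIV :: 's set)" and F: "\<And>i. i \<in> J \<Longrightarrow> F i \<in> sets \<rho>"
  \<comment> \<open>The constraint on coordinate \<open>s\<close> is split off from the cylinder; if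
    \<open>s\<close> is unconstrained, the whole space serves as a trivial constraint.\<close>
  define E where "E = (if s \<in> J then F s else space \<rho>)"
  have E [measurable]: "E \<in> sets \<rho>" using F by (auto simp: E_def)
  define W where "W = {x \<in> space configs. x s \<in> E \<and> (\<forall>l\<in>J - {s}. x l \<in> F l)}"
  define G where "G = {x \<in> space (configs :: ('s \<Rightarrow> 'a) measure). \<forall>l\<in>J - {s}. x l \<in> F l}"
  have W_eq: "prod_emb UNIV (\<lambda>_. \<rho>) J (Pi\<^sub>E J F) = W"
    by (auto simp: W_def prod_emb_def E_def space_PiM PiE_iff extensional_def)
  have "W \<in> sets configs"
    unfolding W_eq[symmetric] using J F by (intro sets_PiM_I) auto
  note [measurable] = this
  have "emeasure ?\<nu> W = (\<integral>\<^sup>+z. indicator W ((\<lambda>(x, u). x(s := u)) z) * (\<lambda>(x, u). ennreal (cdens \<theta> s u x)) z \<partial>(\<mu> \<Otimes>\<^sub>M \<rho>))"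
    by (subst emeasure_distr) (auto simp: emeasure_density intro!: nn_integral_cong split: split_indicator)
  also have "\<dots> = (\<integral>\<^sup>+x. \<integral>\<^sup>+u. indicator W (x(s := u)) * ennreal (cdens \<theta> s u x) \<partial>\<rho> \<partial>\<mu>)"
    by (subst nn_integral_fst[symmetric]) auto
  \<comment> \<open>After the update, membership in \<open>W\<close> separates into
    \<open>u \<in> E\<close> and a condition on the coordinates of \<open>x\<close> other than
    \<open>s\<close>.\<close>
  also have "\<dots> = (\<integral>\<^sup>+x. \<integral>\<^sup>+u. ennreal (cdens \<theta> s u x) * indicator E u * indicator G x \<partial>\<rho> \<partial>\<mu>)"
    by (intro nn_integral_cong) (auto simp: W_def G_def sp space_PiM split: split_indicator)
  also have "\<dots> = emeasure \<mu> W"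
    unfolding W_def G_def using J F E
    by (intro full_conditionals_cylinder[OF fc \<theta>, symmetric]) auto
  finally show "emeasure \<mu> (prod_emb UNIV (\<lambda>_. \<rho>) J (Pi\<^sub>E J F)) = emeasure ?\<nu> (prod_emb UNIV (\<lambda>_. \<rho>) J (Pi\<^sub>E J F))"
    by (simp add: W_eq)
qed (rule sets_distr)

text \<open>The invariance of \<open>\<mu>\<close> under resampling, read as an integral identity by
  change of variables and Fubini.\<close>

lemma integral_resample:
  fixes \<theta> :: "'s::countable \<Rightarrow> 's \<Rightarrow> real" and h :: "('s \<Rightarrow> 'a) \<Rightarrow> real"
  assumes fc: "has_full_conditionals \<rho> A B0 B \<theta> \<mu>"
    and \<theta>: "row_summable \<theta> s"
    and h [measurable]: "h \<in> borel_measurable configs"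
    and bound: "\<And>x. x \<in> space configs \<Longrightarrow> \<bar>h x\<bar> \<le> K"
  shows "(\<integral>x. h x \<partial>\<mu>) = (\<integral>x. \<integral>u. h (x(s := u)) * cdens \<theta> s u x \<partial>\<rho> \<partial>\<mu>)"
proof -
  interpret \<mu>: prob_space \<mu> using fc by (simp add: has_full_conditionals_def)
  interpret pair_sigma_finite \<mu> \<rho> ..
  have sets_\<mu> [measurable_cong]: "sets \<mu> = sets configs" using fc by (simp add: has_full_conditionals_def)
  have sp: "space \<mu> = space configs" using sets_\<mu> by (rule sets_eq_imp_space_eq)
  note [measurable (raw)] = measurable_cdens[of \<theta>, OF \<theta>]
  have upd [measurable]: "(\<lambda>(x, u). x(s := u)) \<in> \<mu> \<Otimes>\<^sub>M \<rho> \<rightarrow>\<^sub>M configs"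
    using measurable_add_dim[of s UNIV "\<lambda>_. \<rho>"] by (simp add: insert_UNIV cong: measurable_cong_sets)
  have h_upd [measurable]: "(\<lambda>z. h ((fst z)(s := snd z))) \<in> borel_measurable (\<mu> \<Otimes>\<^sub>M \<rho>)"
    using measurable_compose[OF upd h] by (simp add: case_prod_unfold)
  let ?\<nu> = "density (\<mu> \<Otimes>\<^sub>M \<rho>) (\<lambda>(x, u). ennreal (cdens \<theta> s u x))"
  have pos: "AE z in \<mu> \<Otimes>\<^sub>M \<rho>. 0 \<le> cdens \<theta> s (snd z) (fst z)"
    using cdens_pos[of \<theta>, OF \<theta>] by (intro AE_I2) (auto simp: space_pair_measure sp less_imp_le)
  have "(\<integral>x. h x \<partial>\<mu>) = (\<integral>x. h x \<partial>distr ?\<nu> configs (\<lambda>(x, u). x(s := u)))"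
    using full_conditionals_resample[OF fc, of s, OF \<theta>] by simp
  also have "\<dots> = (\<integral>z. h ((fst z)(s := snd z)) \<partial>?\<nu>)"
    by (subst integral_distr) (auto simp: case_prod_unfold)
  also have "\<dots> = (\<integral>z. cdens \<theta> s (snd z) (fst z) * h ((fst z)(s := snd z)) \<partial>(\<mu> \<Otimes>\<^sub>M \<rho>))"
    unfolding case_prod_unfold using pos
    by (subst integral_density) auto
  also have "\<dots> = (\<integral>x. \<integral>u. cdens \<theta> s u x * h (x(s := u)) \<partial>\<rho> \<partial>\<mu>)"
  proof (subst integral_fst'[symmetric])
    \<comment> \<open>Fubini needs an integrable integrand on a finite product measure; the bound on
      the log density makes the density at most \<open>exp K'\<close>.\<close>
    obtain K' where K': "\<And>u x. u \<in> space \<rho> \<Longrightarrow> x \<in> space configs \<Longrightarrow> \<bar>ln (cdens \<theta> s u x)\<bar> \<le> K'"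
      using log_cdens_bounded[OF \<theta>] by blast
    show "integrable (\<mu> \<Otimes>\<^sub>M \<rho>) (\<lambda>z. cdens \<theta> s (snd z) (fst z) * h ((fst z)(s := snd z)))"
    proof (rule integrable_pair_bounded[where K = "exp K' * K"])
      fix z assume z: "z \<in> space (\<mu> \<Otimes>\<^sub>M \<rho>)"
      then have u: "snd z \<in> space \<rho>" and x: "fst z \<in> space configs"
        by (auto simp: space_pair_measure sp)
      have pos: "cdens \<theta> s (snd z) (fst z) > 0" by (rule cdens_pos[OF \<theta> x])
      have "cdens \<theta> s (snd z) (fst z) = exp (ln (cdens \<theta> s (snd z) (fst z)))" using pos by simp
      also have "\<dots> \<le> exp K'" using K'[OF u x] by simp
      finally have "cdens \<theta> s (snd z) (fst z) \<le> exp K'" .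
      moreover have "(fst z)(s := snd z) \<in> space configs" using u x by (auto simp: space_PiM)
      ultimately show "\<bar>cdens \<theta> s (snd z) (fst z) * h ((fst z)(s := snd z))\<bar> \<le> exp K' * K"
        using bound pos by (simp add: abs_mult mult_mono)
    qed (auto intro: \<mu>.finite_measure_axioms finite_measure_rho)
  qed simp
  finally show ?thesis by (simp add: mult.commute)
qed

subsection \<open>Lipschitz bounds and almost sure convergence\<close>

text \<open>Evaluating at the configuration's own \<open>x s\<close> makes this a function of one
  observation, so that independent observations give independent values.\<close>

definition log_ratio :: "('s \<Rightarrow> 's \<Rightarrow> real) \<Rightarrow> ('s \<Rightarrow> 's \<Rightarrow> real) \<Rightarrow> 's \<Rightarrow> ('s \<Rightarrow> 'a) \<Rightarrow> real"
  where "log_ratio \<theta> \<eta> s x = ln (cdens \<theta> s (x s) x) - ln (cdens \<eta> s (x s) x)"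

context
  fixes \<theta> \<eta> :: "'s::countable \<Rightarrow> 's \<Rightarrow> real" and s :: 's
  assumes \<theta>: "row_summable \<theta> s" and \<eta>: "row_summable \<eta> s"
begin

lemma measurable_log_ratio: "log_ratio \<theta> \<eta> s \<in> borel_measurable configs"
proof -
  note [measurable (raw)] = measurable_cdens[OF \<theta>] measurable_cdens[OF \<eta>]
  show ?thesis unfolding log_ratio_def[abs_def] by measurable
qed

lemma log_ratio_bound:
  assumes "x \<in> space configs"
  shows "\<bar>log_ratio \<theta> \<eta> s x\<bar> \<le> 2 * (C * row_norm (\<lambda>s l. \<theta> s l - \<eta> s l) s)"
  unfolding log_ratio_def using log_cdens_diff_le[OF \<theta> \<eta> config_apply[OF assms] assms] .

text \<open>Truncation to a window only shrinks the row norm of the difference, so the full bound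
  holds for every \<open>\<Lambda>\<close>. This is the source of uniformity in
  \<open>n\<close>.\<close>

lemma log_cond_density_diff_le:
  assumes "x \<in> space configs" "u \<in> space \<rho>"
  shows "\<bar>ln (cond_density \<rho> A B0 B \<Lambda> \<theta> s u x) - ln (cond_density \<rho> A B0 B \<Lambda> \<eta> s u x)\<bar>
    \<le> 2 * (C * row_norm (\<lambda>s l. \<theta> s l - \<eta> s l) s)"
proof -
  have "row_norm (\<lambda>s l. row_restrict \<Lambda> \<theta> s l - row_restrict \<Lambda> \<eta> s l) s \<le> row_norm (\<lambda>s l. \<theta> s l - \<eta> s l) s"
    by (intro row_norm_mono row_summable_diff \<theta> \<eta>) (auto simp: row_restrict_def)
  then have "2 * (C * row_norm (\<lambda>s l. row_restrict \<Lambda> \<theta> s l - row_restrict \<Lambda> \<eta> s l) s)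
      \<le> 2 * (C * row_norm (\<lambda>s l. \<theta> s l - \<eta> s l) s)"
    using C_nonneg by (intro mult_left_mono) auto
  with log_cdens_diff_le[OF row_summable_restrict[OF \<theta>] row_summable_restrict[OF \<eta>] assms(2,1)]
  show ?thesis unfolding cond_density_row_restrict[of \<rho> A B0 B \<Lambda>] by (rule order.trans)
qed

end

section \<open>Site divergences and their sum\<close>

context
  fixes \<theta>\<^sub>0 :: "'s::{countable,linorder} \<Rightarrow> 's \<Rightarrow> real" and \<mu> :: "('s \<Rightarrow> 'a) measure"
  assumes fc: "has_full_conditionals \<rho> A B0 B \<theta>\<^sub>0 \<mu>" and \<theta>\<^sub>0: "\<theta>\<^sub>0 \<in> matrices"
begin

interpretation \<mu>: prob_space \<mu>
  using fc by (simp add: has_full_conditionals_def)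

lemma sets_mu [measurable_cong]: "sets \<mu> = sets configs"
  using fc by (simp add: has_full_conditionals_def)

lemma space_mu: "space \<mu> = space configs"
  by (rule sets_eq_imp_space_eq[OF sets_mu])

abbreviation "k \<equiv> k_site \<rho> A B0 B \<mu> \<theta>\<^sub>0"

lemma row_summable_shift: "row_summable \<theta>\<^sub>0 s" "\<theta> \<in> matrices \<Longrightarrow> row_summable (madd \<theta>\<^sub>0 \<theta>) s"
  using \<theta>\<^sub>0 by (auto intro: matrices_row_summable matrices_madd)

text \<open>Resampling coordinate \<open>s\<close> turns the expectation of the log ratio into a
  double integral, in which the densities keep \<open>x\<close> and only their argument becomes
  \<open>u\<close>. The result is the divergence, the minus sign being absorbed by the order of the
  quotient.\<close>

lemma k_site_eq_expectation:
  assumes "\<theta> \<in> matrices"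
  shows "k \<theta> s = (\<integral>x. log_ratio \<theta>\<^sub>0 (madd \<theta>\<^sub>0 \<theta>) s x \<partial>\<mu>)"
proof -
  note r = row_summable_shift(1)[of s] row_summable_shift(2)[OF assms, of s]
  have "(\<integral>x. log_ratio \<theta>\<^sub>0 (madd \<theta>\<^sub>0 \<theta>) s x \<partial>\<mu>)
      = (\<integral>x. \<integral>u. log_ratio \<theta>\<^sub>0 (madd \<theta>\<^sub>0 \<theta>) s (x(s := u)) * cdens \<theta>\<^sub>0 s u x \<partial>\<rho> \<partial>\<mu>)"
    by (rule integral_resample[OF fc r(1) measurable_log_ratio[OF r] log_ratio_bound[OF r]])
  also have "\<dots> = k \<theta> s"
    unfolding k_site_def
  proof (intro Bochner_Integration.integral_cong refl)
    fix x u assume "x \<in> space \<mu>"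
    then have x: "x \<in> space configs" by (simp add: space_mu)
    have "cdens \<theta>\<^sub>0 s u x > 0" "cdens (madd \<theta>\<^sub>0 \<theta>) s u x > 0"
      by (rule cdens_pos[OF r(1) x], rule cdens_pos[OF r(2) x])
    then show "log_ratio \<theta>\<^sub>0 (madd \<theta>\<^sub>0 \<theta>) s (x(s := u)) * cdens \<theta>\<^sub>0 s u x =
        - ln (cdens (madd \<theta>\<^sub>0 \<theta>) s u x / cdens \<theta>\<^sub>0 s u x) * cdens \<theta>\<^sub>0 s u x"
      by (simp add: log_ratio_def cdens_fun_upd ln_div)
  qed
  finally show ?thesis by simp
qed

lemma integrable_log_ratio:
  assumes "\<theta> \<in> matrices"
  shows "integrable \<mu> (log_ratio \<theta>\<^sub>0 (madd \<theta>\<^sub>0 \<theta>) s)"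
proof (rule \<mu>.integrable_const_bound)
  note r = row_summable_shift(1)[of s] row_summable_shift(2)[OF assms, of s]
  show "AE x in \<mu>. norm (log_ratio \<theta>\<^sub>0 (madd \<theta>\<^sub>0 \<theta>) s x) \<le> 2 * (C * row_norm (\<lambda>s l. \<theta>\<^sub>0 s l - madd \<theta>\<^sub>0 \<theta> s l) s)"
    using log_ratio_bound[OF r] by (intro AE_I2) (simp add: space_mu)
  show "log_ratio \<theta>\<^sub>0 (madd \<theta>\<^sub>0 \<theta>) s \<in> borel_measurable \<mu>"
    using measurable_log_ratio[OF r] by (simp cong: measurable_cong_sets add: sets_mu)
qed

lemma k_site_diff_le:
  assumes \<theta>: "\<theta> \<in> matrices" and \<eta>: "\<eta> \<in> matrices"
  shows "\<bar>k \<theta> s - k \<eta> s\<bar> \<le> 2 * C * row_norm (\<lambda>s l. \<theta> s l - \<eta> s l) s"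
proof -
  let ?f = "\<lambda>\<theta> x. log_ratio \<theta>\<^sub>0 (madd \<theta>\<^sub>0 \<theta>) s x"
  let ?b = "2 * C * row_norm (\<lambda>s l. \<theta> s l - \<eta> s l) s"
  have int: "integrable \<mu> (?f \<theta>)" "integrable \<mu> (?f \<eta>)"
    by (rule integrable_log_ratio[OF \<theta>], rule integrable_log_ratio[OF \<eta>])
  have bound: "\<bar>?f \<theta> x - ?f \<eta> x\<bar> \<le> ?b" if "x \<in> space \<mu>" for x
  proof -
    \<comment> \<open>The reference density for \<open>\<theta>\<^sub>0\<close> cancels, leaving a
      log ratio of the two perturbed matrices.\<close>
    have "?f \<theta> x - ?f \<eta> x = - log_ratio (madd \<theta>\<^sub>0 \<theta>) (madd \<theta>\<^sub>0 \<eta>) s x"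
      by (simp add: log_ratio_def)
    then show ?thesis
      using log_ratio_bound[OF row_summable_shift(2)[OF \<theta>, of s] row_summable_shift(2)[OF \<eta>, of s], of x] that
      by (simp add: space_mu row_norm_madd_diff)
  qed
  have abs_int: "integrable \<mu> (\<lambda>x. \<bar>?f \<theta> x - ?f \<eta> x\<bar>)"
    by (rule integrable_abs[OF Bochner_Integration.integrable_diff[OF int]])
  have "k \<theta> s - k \<eta> s = (\<integral>x. ?f \<theta> x - ?f \<eta> x \<partial>\<mu>)"
    using int by (simp add: k_site_eq_expectation \<theta> \<eta>)
  then have "\<bar>k \<theta> s - k \<eta> s\<bar> \<le> (\<integral>x. \<bar>?f \<theta> x - ?f \<eta> x\<bar> \<partial>\<mu>)"
    by (simp only: integral_abs_bound)
  also have "\<dots> \<le> (\<integral>x. ?b \<partial>\<mu>)"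
    by (rule integral_mono[OF abs_int \<mu>.integrable_const bound])
  finally show ?thesis by (simp add: \<mu>.prob_space)
qed

lemma k_site_zero: "k (\<lambda>_ _. 0) s = 0"
proof -
  have "madd \<theta>\<^sub>0 (\<lambda>_ _. 0) = \<theta>\<^sub>0" by (simp add: madd_def)
  then show ?thesis
    using k_site_eq_expectation[OF M1_matrices[OF M1_zero], of s] by (simp add: log_ratio_def[abs_def])
qed

lemma k_site_bound:
  assumes "\<theta> \<in> matrices"
  shows "\<bar>k \<theta> s\<bar> \<le> 2 * C * row_norm \<theta> s"
  using k_site_diff_le[OF assms M1_matrices[OF M1_zero], of s] by (simp add: k_site_zero)

lemma k_site_summable:
  assumes "\<theta> \<in> M1"
  shows "k \<theta> summable_on UNIV"
proof (rule summable_on_iff_abs_summable_on_real[THEN iffD2], rule summable_on_comparison_test)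
  show "(\<lambda>s. 2 * C * row_norm \<theta> s) summable_on UNIV"
    by (intro summable_on_cmult_right row_norm_summable assms)
  show "norm (k \<theta> s) \<le> 2 * C * row_norm \<theta> s" for s
    using k_site_bound[OF M1_matrices[OF assms], of s] by simp
qed simp

text \<open>Site divergences are dominated by multiples of row norms, so on \<open>M1\<close> the
  extended-real sum is an ordinary finite one.\<close>

lemma k_total_eq:
  assumes "\<theta> \<in> M1"
  shows "k_total \<rho> A B0 B \<mu> \<theta>\<^sub>0 \<theta> = ereal (infsum (k \<theta>) UNIV)"
  unfolding k_total_def
  by (rule infsumI, rule has_sum_ereal, rule has_sum_infsum, rule k_site_summable[OF assms])

lemma k_lipschitz:
  assumes \<theta>: "\<theta> \<in> M1" and \<eta>: "\<eta> \<in> M1"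
  shows "\<bar>infsum (k \<theta>) UNIV - infsum (k \<eta>) UNIV\<bar> \<le> 4 * C * dist_M1 \<theta> \<eta>"
proof -
  let ?\<zeta> = "\<lambda>s l. \<theta> s l - \<eta> s l"
  have "\<bar>infsum (k \<theta>) UNIV - infsum (k \<eta>) UNIV\<bar> \<le> (\<Sum>\<^sub>\<infinity>s. 2 * C * row_norm ?\<zeta> s)"
    by (intro abs_infsum_diff_le k_site_summable summable_on_cmult_right row_norm_summable
        k_site_diff_le M1_matrices M1_diff \<theta> \<eta>)
  also have "\<dots> = 2 * C * infsum (row_norm ?\<zeta>) UNIV"
    by (rule infsum_cmult_right')
  also have "\<dots> \<le> 2 * C * (2 * norm_M1 ?\<zeta>)"
    using C_nonneg by (intro mult_left_mono infsum_row_norm_le M1_diff \<theta> \<eta>) auto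
  finally show ?thesis by (simp add: dist_M1_def)
qed

section \<open>The objective for a fixed sample\<close>

context
  fixes D :: "nat \<Rightarrow> 's set" and q :: "real \<Rightarrow> real \<Rightarrow> real" and lam :: "nat \<Rightarrow> real" and K :: real
    and x :: "nat \<Rightarrow> 's \<Rightarrow> 'a"
  assumes D_finite: "\<And>n. finite (D n)"
    and q_lipschitz: "\<And>n a b. a \<ge> 0 \<Longrightarrow> b \<ge> 0 \<Longrightarrow> \<bar>q (lam n) a - q (lam n) b\<bar> \<le> K * lam n * \<bar>a - b\<bar>"
    and K_lam_nonneg: "\<And>n. K * lam n \<ge> 0"
    and x: "\<And>i. i \<ge> 1 \<Longrightarrow> x i \<in> space configs"
begin

abbreviation "objective \<equiv> U \<rho> A B0 B D q lam \<theta>\<^sub>0 x"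

text \<open>The reference penalties cancel, and the reverse triangle inequality reduces each term to
  an entry of \<open>\<theta> - \<eta>\<close>. Each ordered pair occurs once, as in the norm, so no
  factor 2 appears.\<close>

lemma penalty_diff_le:
  assumes \<theta>: "\<theta> \<in> M1" and \<eta>: "\<eta> \<in> M1"
  shows "\<bar>(\<Sum>(s, l)\<in>ordered_pairs (D n). q (lam n) \<bar>\<theta>\<^sub>0 s l + \<theta> s l\<bar> - q (lam n) \<bar>\<theta>\<^sub>0 s l\<bar>)
    - (\<Sum>(s, l)\<in>ordered_pairs (D n). q (lam n) \<bar>\<theta>\<^sub>0 s l + \<eta> s l\<bar> - q (lam n) \<bar>\<theta>\<^sub>0 s l\<bar>)\<bar>
    \<le> K * lam n * dist_M1 \<theta> \<eta>" (is "\<bar>?S \<theta> - ?S \<eta>\<bar> \<le> _")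
proof -
  have "?S \<theta> - ?S \<eta> = (\<Sum>(s, l)\<in>ordered_pairs (D n). q (lam n) \<bar>\<theta>\<^sub>0 s l + \<theta> s l\<bar> - q (lam n) \<bar>\<theta>\<^sub>0 s l + \<eta> s l\<bar>)"
    unfolding sum_subtractf[symmetric] by (intro sum.cong) auto
  also have "\<bar>\<dots>\<bar> \<le> (\<Sum>(s, l)\<in>ordered_pairs (D n). K * lam n * \<bar>\<theta> s l - \<eta> s l\<bar>)"
  proof (rule order.trans[OF sum_abs sum_mono], clarify)
    fix s l
    have "\<bar>q (lam n) \<bar>\<theta>\<^sub>0 s l + \<theta> s l\<bar> - q (lam n) \<bar>\<theta>\<^sub>0 s l + \<eta> s l\<bar>\<bar>
        \<le> K * lam n * \<bar>\<bar>\<theta>\<^sub>0 s l + \<theta> s l\<bar> - \<bar>\<theta>\<^sub>0 s l + \<eta> s l\<bar>\<bar>"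
      by (rule q_lipschitz) auto
    also have "\<dots> \<le> K * lam n * \<bar>\<theta> s l - \<eta> s l\<bar>"
      by (rule mult_left_mono[OF _ K_lam_nonneg]) linarith
    finally show "\<bar>q (lam n) \<bar>\<theta>\<^sub>0 s l + \<theta> s l\<bar> - q (lam n) \<bar>\<theta>\<^sub>0 s l + \<eta> s l\<bar>\<bar> \<le> K * lam n * \<bar>\<theta> s l - \<eta> s l\<bar>" .
  qed
  also have "\<dots> = K * lam n * (\<Sum>(s, l)\<in>ordered_pairs (D n). \<bar>\<theta> s l - \<eta> s l\<bar>)"
    by (simp add: sum_distrib_left case_prod_unfold)
  also have "\<dots> \<le> K * lam n * dist_M1 \<theta> \<eta>"
    unfolding dist_M1_def
    by (intro mult_left_mono K_lam_nonneg sum_ordered_pairs_le_norm_M1[OF M1_diff[OF \<theta> \<eta>] D_finite])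
  finally show ?thesis .
qed

lemma U_lipschitz:
  assumes \<theta>: "\<theta> \<in> M1" and \<eta>: "\<eta> \<in> M1"
  shows "\<bar>objective n \<theta> - objective n \<eta>\<bar> \<le> (4 * C + K * lam n / real n) * dist_M1 \<theta> \<eta>"
proof (cases "n = 0")
  \<comment> \<open>Division by zero yields 0, so both objectives vanish at
    \<open>n = 0\<close>.\<close>
  case True
  have "dist_M1 \<theta> \<eta> \<ge> 0" by (rule Metric_space.nonneg[OF Metric_space_M1])
  with True C_nonneg show ?thesis by (simp add: U_def)
next
  case False
  let ?\<zeta> = "\<lambda>s l. \<theta> s l - \<eta> s l"
  define L where "L \<theta> i s = ln (cond_density \<rho> A B0 B (D n) \<theta>\<^sub>0 s (x i s) (x i))
      - ln (cond_density \<rho> A B0 B (D n) (madd \<theta>\<^sub>0 \<theta>) s (x i s) (x i))" for \<theta> i s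
  define S where "S \<theta> = (\<Sum>(s, l)\<in>ordered_pairs (D n). q (lam n) \<bar>\<theta>\<^sub>0 s l + \<theta> s l\<bar> - q (lam n) \<bar>\<theta>\<^sub>0 s l\<bar>)" for \<theta>
  have U_eq: "objective n \<theta> = 1 / real n * (\<Sum>i=1..n. \<Sum>s\<in>D n. L \<theta> i s) + 1 / real n * S \<theta>" for \<theta>
    by (simp add: U_def L_def S_def)
  have L_le: "\<bar>(\<Sum>s\<in>D n. L \<theta> i s) - (\<Sum>s\<in>D n. L \<eta> i s)\<bar> \<le> 4 * C * dist_M1 \<theta> \<eta>" if "i \<ge> 1" for i
  proof -
    have "\<bar>(\<Sum>s\<in>D n. L \<theta> i s) - (\<Sum>s\<in>D n. L \<eta> i s)\<bar> \<le> (\<Sum>s\<in>D n. \<bar>L \<theta> i s - L \<eta> i s\<bar>)"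
      unfolding sum_subtractf[symmetric] by (rule sum_abs)
    also have "\<dots> \<le> (\<Sum>s\<in>D n. 2 * C * row_norm ?\<zeta> s)"
    proof (rule sum_mono)
      fix s
      show "\<bar>L \<theta> i s - L \<eta> i s\<bar> \<le> 2 * C * row_norm ?\<zeta> s"
        using log_cond_density_diff_le[OF row_summable_shift(2)[OF M1_matrices[OF \<theta>]] row_summable_shift(2)[OF M1_matrices[OF \<eta>]]
            x[OF that] config_apply[OF x[OF that]], of "D n" s s]
        by (simp add: L_def row_norm_madd_diff abs_minus_commute)
    qed
    also have "\<dots> = 2 * C * (\<Sum>s\<in>D n. row_norm ?\<zeta> s)" by (simp add: sum_distrib_left)
    also have "\<dots> \<le> 2 * C * (2 * norm_M1 ?\<zeta>)"
      using C_nonneg by (intro mult_left_mono sum_row_norm_le[OF M1_diff[OF \<theta> \<eta>] D_finite]) auto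
    finally show ?thesis by (simp add: dist_M1_def)
  qed
  have "\<bar>(\<Sum>i=1..n. \<Sum>s\<in>D n. L \<theta> i s) - (\<Sum>i=1..n. \<Sum>s\<in>D n. L \<eta> i s)\<bar> \<le> (\<Sum>i=1..n. 4 * C * dist_M1 \<theta> \<eta>)"
    unfolding sum_subtractf[symmetric]
    by (rule order.trans[OF sum_abs sum_mono]) (use L_le in \<open>simp add: sum_subtractf\<close>)
  then have 1: "\<bar>(\<Sum>i=1..n. \<Sum>s\<in>D n. L \<theta> i s) - (\<Sum>i=1..n. \<Sum>s\<in>D n. L \<eta> i s)\<bar> \<le> real n * (4 * C * dist_M1 \<theta> \<eta>)"
    by simp
  have 2: "\<bar>S \<theta> - S \<eta>\<bar> \<le> K * lam n * dist_M1 \<theta> \<eta>"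
    unfolding S_def by (rule penalty_diff_le[OF \<theta> \<eta>])
  have "objective n \<theta> - objective n \<eta> = (((\<Sum>i=1..n. \<Sum>s\<in>D n. L \<theta> i s) - (\<Sum>i=1..n. \<Sum>s\<in>D n. L \<eta> i s)) + (S \<theta> - S \<eta>)) / real n"
    unfolding U_eq by (simp add: add_divide_distrib diff_divide_distrib)
  also have "\<bar>\<dots>\<bar> \<le> (real n * (4 * C * dist_M1 \<theta> \<eta>) + K * lam n * dist_M1 \<theta> \<eta>) / real n"
    unfolding abs_divide using 1 2 False by (intro frac_le) auto
  also have "\<dots> = (4 * C + K * lam n / real n) * dist_M1 \<theta> \<eta>"
    using False by (simp add: field_simps)
  finally show ?thesis .
qed

text \<open>Once the window contains a suitable finite set \<open>T\<close>, the objective is a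
  fixed finite sum of sample averages of exact log ratios plus a penalty of order
  \<open>lam n / n\<close>.\<close>

lemma U_tendsto_finite_support:
  assumes D: "incseq D" "(\<Union>n. D n) = UNIV"
    and range0: "\<And>s. finite {l \<in> UNIV - {s}. \<theta>\<^sub>0 s l \<noteq> 0}"
    and lam: "(\<lambda>n. lam n / real n) \<longlonglongrightarrow> 0"
    and \<theta>: "\<theta> \<in> M1" "finite {s. \<exists>l. \<theta> s l \<noteq> 0}" "\<And>s. finite {l. \<theta> s l \<noteq> 0}"
    and average: "\<And>s. (\<lambda>n. 1 / real n * (\<Sum>i=1..n. log_ratio \<theta>\<^sub>0 (madd \<theta>\<^sub>0 \<theta>) s (x i))) \<longlonglongrightarrow> k \<theta> s"
  shows "(\<lambda>n. objective n \<theta>) \<longlonglongrightarrow> infsum (k \<theta>) UNIV"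
proof -
  define F where "F = {s. \<exists>l. \<theta> s l \<noteq> 0}"
  have F: "finite F" using \<theta>(2) by (simp add: F_def)
  \<comment> \<open>The perturbed sites together with every neighbour they have under
    \<open>\<theta>\<^sub>0\<close> or \<open>\<theta>\<close>; the finite range of
    \<open>\<theta>\<^sub>0\<close> keeps it finite.\<close>
  define T where "T = F \<union> (\<Union>s\<in>F. {l \<in> UNIV - {s}. \<theta>\<^sub>0 s l \<noteq> 0} \<union> {l. \<theta> s l \<noteq> 0})"
  have T: "finite T" using F range0 \<theta>(3) by (auto simp: T_def)
  have not_F: "cond_density \<rho> A B0 B \<Lambda> (madd \<theta>\<^sub>0 \<theta>) s u y = cond_density \<rho> A B0 B \<Lambda> \<theta>\<^sub>0 s u y"
    if "s \<notin> F" for \<Lambda> s u and y :: "'s \<Rightarrow> 'a"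
    by (rule cond_density_cong_row) (use that in \<open>simp add: F_def madd_def\<close>)
  define S where "S n = (\<Sum>(s, l)\<in>ordered_pairs (D n). q (lam n) \<bar>\<theta>\<^sub>0 s l + \<theta> s l\<bar> - q (lam n) \<bar>\<theta>\<^sub>0 s l\<bar>)" for n
  have eq: "(\<Sum>s\<in>F. 1 / real n * (\<Sum>i=1..n. log_ratio \<theta>\<^sub>0 (madd \<theta>\<^sub>0 \<theta>) s (x i))) + 1 / real n * S n = objective n \<theta>"
    if n: "T \<subseteq> D n" for n
  proof -
    have "(\<Sum>s\<in>D n. ln (cond_density \<rho> A B0 B (D n) \<theta>\<^sub>0 s (x i s) (x i))
        - ln (cond_density \<rho> A B0 B (D n) (madd \<theta>\<^sub>0 \<theta>) s (x i s) (x i))) =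
        (\<Sum>s\<in>F. log_ratio \<theta>\<^sub>0 (madd \<theta>\<^sub>0 \<theta>) s (x i))" for i
    proof (rule sum.mono_neutral_cong_right)
      show "F \<subseteq> D n" using n by (auto simp: T_def)
      show "\<forall>s\<in>D n - F. ln (cond_density \<rho> A B0 B (D n) \<theta>\<^sub>0 s (x i s) (x i))
          - ln (cond_density \<rho> A B0 B (D n) (madd \<theta>\<^sub>0 \<theta>) s (x i s) (x i)) = 0"
        using not_F by simp
      fix s assume s: "s \<in> F"
      have "{l. l \<noteq> s \<and> \<theta>\<^sub>0 s l \<noteq> 0} \<subseteq> T" "{l. \<theta> s l \<noteq> 0} \<subseteq> T"
        using s unfolding T_def by blast+
      moreover have "{l. l \<noteq> s \<and> madd \<theta>\<^sub>0 \<theta> s l \<noteq> 0} \<subseteq> {l. l \<noteq> s \<and> \<theta>\<^sub>0 s l \<noteq> 0} \<union> {l. \<theta> s l \<noteq> 0}"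
        by (auto simp: madd_def)
      ultimately have range: "{l. l \<noteq> s \<and> \<theta>\<^sub>0 s l \<noteq> 0} \<subseteq> D n" "{l. l \<noteq> s \<and> madd \<theta>\<^sub>0 \<theta> s l \<noteq> 0} \<subseteq> D n"
        using n by blast+
      show "ln (cond_density \<rho> A B0 B (D n) \<theta>\<^sub>0 s (x i s) (x i))
          - ln (cond_density \<rho> A B0 B (D n) (madd \<theta>\<^sub>0 \<theta>) s (x i s) (x i)) = log_ratio \<theta>\<^sub>0 (madd \<theta>\<^sub>0 \<theta>) s (x i)"
        by (simp only: log_ratio_def cond_density_finite_range[where \<theta> = \<theta>\<^sub>0 and s = s, OF range(1)]
            cond_density_finite_range[where \<theta> = "madd \<theta>\<^sub>0 \<theta>" and s = s, OF range(2)])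
    qed (rule D_finite)
    then have "objective n \<theta> = 1 / real n * (\<Sum>i=1..n. \<Sum>s\<in>F. log_ratio \<theta>\<^sub>0 (madd \<theta>\<^sub>0 \<theta>) s (x i)) + 1 / real n * S n"
      by (simp only: U_def S_def)
    also have "(\<Sum>i=1..n. \<Sum>s\<in>F. log_ratio \<theta>\<^sub>0 (madd \<theta>\<^sub>0 \<theta>) s (x i))
        = (\<Sum>s\<in>F. \<Sum>i=1..n. log_ratio \<theta>\<^sub>0 (madd \<theta>\<^sub>0 \<theta>) s (x i))"
      by (rule sum.swap)
    finally show ?thesis by (simp only: sum_distrib_left)
  qed
  have k_F: "infsum (k \<theta>) UNIV = (\<Sum>s\<in>F. k \<theta> s)"
  proof -
    have "k \<theta> s = 0" if "s \<notin> F" for s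
    proof -
      have "log_ratio \<theta>\<^sub>0 (madd \<theta>\<^sub>0 \<theta>) s = (\<lambda>_. 0)"
        using not_F[OF that] by (simp add: log_ratio_def fun_eq_iff)
      then show ?thesis by (simp add: k_site_eq_expectation[OF M1_matrices[OF \<theta>(1)]])
    qed
    then have "infsum (k \<theta>) UNIV = infsum (k \<theta>) F" by (intro infsum_cong_neutral) auto
    then show ?thesis using F by simp
  qed
  \<comment> \<open>Comparison with the zero perturbation, whose penalty difference is 0, bounds
    \<open>S n\<close> by \<open>K * lam n\<close> times the norm of \<open>\<theta>\<close>,
    whatever the size of the window.\<close>
  have "(\<lambda>n. 1 / real n * S n) \<longlonglongrightarrow> 0"
  proof (rule Lim_null_comparison)
    have S_le: "\<bar>S n\<bar> \<le> K * lam n * dist_M1 \<theta> (\<lambda>_ _. 0)" for n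
      using penalty_diff_le[OF \<theta>(1) M1_zero, of n] by (simp add: S_def)
    show "\<forall>\<^sub>F n in sequentially. norm (1 / real n * S n) \<le> K * dist_M1 \<theta> (\<lambda>_ _. 0) * (lam n / real n)"
    proof (intro always_eventually allI)
      fix n
      have "norm (1 / real n * S n) = \<bar>S n\<bar> / real n" by (simp add: abs_mult)
      also have "\<dots> \<le> K * lam n * dist_M1 \<theta> (\<lambda>_ _. 0) / real n"
        by (rule divide_right_mono[OF S_le]) simp
      finally show "norm (1 / real n * S n) \<le> K * dist_M1 \<theta> (\<lambda>_ _. 0) * (lam n / real n)"
        by (simp add: mult_ac)
    qed
    show "(\<lambda>n. K * dist_M1 \<theta> (\<lambda>_ _. 0) * (lam n / real n)) \<longlonglongrightarrow> 0"
      by (rule tendsto_mult_right_zero[OF lam])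
  qed
  with average have "(\<lambda>n. (\<Sum>s\<in>F. 1 / real n * (\<Sum>i=1..n. log_ratio \<theta>\<^sub>0 (madd \<theta>\<^sub>0 \<theta>) s (x i))) + 1 / real n * S n)
      \<longlonglongrightarrow> (\<Sum>s\<in>F. k \<theta> s) + 0"
    by (intro tendsto_add tendsto_sum)
  then have "(\<lambda>n. (\<Sum>s\<in>F. 1 / real n * (\<Sum>i=1..n. log_ratio \<theta>\<^sub>0 (madd \<theta>\<^sub>0 \<theta>) s (x i))) + 1 / real n * S n)
      \<longlonglongrightarrow> infsum (k \<theta>) UNIV"
    by (simp add: k_F)
  then show ?thesis
    by (rule Lim_transform_eventually) (use incseq_finite_subset[OF D T] eq in \<open>auto elim: eventually_mono\<close>)
qed

text \<open>This is deterministic: the sample \<open>x\<close> is fixed, and probability enters only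
  through the assumed limits of averages over the countable family.\<close>

lemma epi_converges_if_averages:
  assumes D: "incseq D" "(\<Union>n. D n) = UNIV"
    and range0: "\<And>s. finite {l \<in> UNIV - {s}. \<theta>\<^sub>0 s l \<noteq> 0}"
    and lam: "(\<lambda>n. lam n / real n) \<longlonglongrightarrow> 0"
    and average: "\<And>es s. (\<lambda>n. 1 / real n * (\<Sum>i=1..n. log_ratio \<theta>\<^sub>0 (madd \<theta>\<^sub>0 (rational_matrix es)) s (x i)))
      \<longlonglongrightarrow> k (rational_matrix es) s"
  shows "epi_converges M1_metric (\<lambda>n \<theta>. ereal (objective n \<theta>)) (k_total \<rho> A B0 B \<mu> \<theta>\<^sub>0)"
proof -
  have "(\<lambda>n. 4 * C + K * (lam n / real n)) \<longlonglongrightarrow> 4 * C + K * 0"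
    by (intro tendsto_intros lam)
  \<comment> \<open>The Lipschitz constants vary with \<open>n\<close> but converge, hence have a
    common bound.\<close>
  then have "Bseq (\<lambda>n. 4 * C + K * (lam n / real n))"
    by (intro convergent_imp_Bseq convergentI)
  then obtain L where L: "\<And>n. \<bar>4 * C + K * (lam n / real n)\<bar> \<le> L"
    by (auto simp: Bseq_def)
  \<comment> \<open>At index 0 the penalty part is a division by zero and disappears, so the same
    \<open>L\<close> also serves for the limit function.\<close>
  have "4 * C \<le> L" using L[of 0] by simp
  have "epi_converges M1_metric (\<lambda>n \<theta>. ereal (objective n \<theta>)) (\<lambda>\<theta>. ereal (infsum (k \<theta>) UNIV))"
  proof (rule epi_converges_if_lipschitz[where Q = "range rational_matrix" and L = L])
    fix n and \<theta> \<eta> :: "'s \<Rightarrow> 's \<Rightarrow> real" assume "\<theta> \<in> mspace M1_metric" "\<eta> \<in> mspace M1_metric"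
    then have mem: "\<theta> \<in> M1" "\<eta> \<in> M1" by simp_all
    have nonneg: "dist_M1 \<theta> \<eta> \<ge> 0" by (rule Metric_space.nonneg[OF Metric_space_M1])
    have "(4 * C + K * lam n / real n) * dist_M1 \<theta> \<eta> \<le> L * dist_M1 \<theta> \<eta>"
      using L[of n] nonneg by (intro mult_right_mono) auto
    then show "\<bar>objective n \<theta> - objective n \<eta>\<bar> \<le> L * mdist M1_metric \<theta> \<eta>"
      using U_lipschitz[OF mem, of n] by simp
    have "4 * C * dist_M1 \<theta> \<eta> \<le> L * dist_M1 \<theta> \<eta>"
      using \<open>4 * C \<le> L\<close> nonneg by (rule mult_right_mono)
    then show "\<bar>infsum (k \<theta>) UNIV - infsum (k \<eta>) UNIV\<bar> \<le> L * mdist M1_metric \<theta> \<eta>"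
      using k_lipschitz[OF mem] by simp
  next
    fix \<theta> :: "'s \<Rightarrow> 's \<Rightarrow> real" and e :: real assume "\<theta> \<in> mspace M1_metric" "e > 0"
    then show "\<exists>d\<in>range rational_matrix. mdist M1_metric \<theta> d < e"
      using rational_matrix_dense by simp
  next
    show "range rational_matrix \<subseteq> mspace M1_metric" using rational_matrix_M1 by auto
  next
    fix \<theta> :: "'s \<Rightarrow> 's \<Rightarrow> real" assume "\<theta> \<in> range rational_matrix"
    then obtain es where "\<theta> = rational_matrix es" by blast
    then show "(\<lambda>n. objective n \<theta>) \<longlonglongrightarrow> infsum (k \<theta>) UNIV"
      using average[of es]
      by (simp add: U_tendsto_finite_support[OF D range0 lam] rational_matrix_M1 rational_matrix_rows)
  qed
  then show ?thesis
    by (simp add: epi_converges_def k_total_eq)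
qed

end

section \<open>Almost sure limits of log ratio averages\<close>

text \<open>Bounded measurable functions of independent, identically distributed configurations obey
  the strong law; resampling identifies their mean as the site divergence. The null set may depend
  on \<open>\<theta>\<close> and \<open>s\<close>.\<close>

lemma AE_average_log_ratio:
  assumes P: "prob_space P" and indep: "prob_space.indep_vars P (\<lambda>_. configs) Xs {1..}"
    and distr: "\<And>i. i \<ge> 1 \<Longrightarrow> distr P configs (Xs i) = \<mu>"
    and \<theta>: "\<theta> \<in> matrices"
  shows "AE \<omega> in P. (\<lambda>n. 1 / real n * (\<Sum>i=1..n. log_ratio \<theta>\<^sub>0 (madd \<theta>\<^sub>0 \<theta>) s (Xs i \<omega>))) \<longlonglongrightarrow> k \<theta> s"
proof -
  interpret P: prob_space P by (rule P)
  note r = row_summable_shift(1)[of s] row_summable_shift(2)[OF \<theta>, of s]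
  have Xs: "Xs i \<in> P \<rightarrow>\<^sub>M configs" if "i \<ge> 1" for i
    using indep that by (auto simp: P.indep_vars_def)
  show ?thesis
  proof (rule P.strong_law_bounded)
    show "P.indep_vars (\<lambda>_. borel) (\<lambda>i \<omega>. log_ratio \<theta>\<^sub>0 (madd \<theta>\<^sub>0 \<theta>) s (Xs i \<omega>)) {1..}"
      by (rule P.indep_vars_compose2[OF indep]) (rule measurable_log_ratio[OF r])
    show "\<bar>log_ratio \<theta>\<^sub>0 (madd \<theta>\<^sub>0 \<theta>) s (Xs i \<omega>)\<bar> \<le> 2 * (C * row_norm (\<lambda>s l. \<theta>\<^sub>0 s l - madd \<theta>\<^sub>0 \<theta> s l) s)"
      if "i \<ge> 1" "\<omega> \<in> space P" for i \<omega>
      by (rule log_ratio_bound[OF r measurable_space[OF Xs[OF that(1)] that(2)]])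
    show "P.expectation (\<lambda>\<omega>. log_ratio \<theta>\<^sub>0 (madd \<theta>\<^sub>0 \<theta>) s (Xs i \<omega>)) = k \<theta> s" if "i \<ge> 1" for i
      using integral_distr[OF Xs[OF that] measurable_log_ratio[OF r]]
      by (simp add: distr[OF that] k_site_eq_expectation[OF \<theta>])
  qed
qed

end

end

section \<open>Epi-convergence\<close>

lemma sup_norm_bound:
  assumes "sup_norm X f < \<infinity>"
  obtains c where "\<And>x. x \<in> X \<Longrightarrow> \<bar>f x\<bar> \<le> c"
proof -
  obtain c where c: "sup_norm X f \<le> ereal c"
    using assms by (cases "sup_norm X f") (auto intro: that)
  have "\<bar>f x\<bar> \<le> c" if "x \<in> X" for x
    using c that SUP_upper[of x X "\<lambda>x. ereal \<bar>f x\<bar>"]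
    by (simp add: sup_norm_def) (meson ereal_less_eq(3) order.trans)
  then show ?thesis by (rule that)
qed

lemma deriv_quotient_sup_bound:
  fixes q :: "real \<Rightarrow> real \<Rightarrow> real"
  assumes "(SUP l\<in>{0<..}. SUP x\<in>{0<..}. ereal (\<bar>deriv (q l) x\<bar> / l)) < \<infinity>"
  obtains K where "K \<ge> 0" "\<And>l x. l > 0 \<Longrightarrow> x > 0 \<Longrightarrow> \<bar>deriv (q l) x\<bar> \<le> K * l"
proof -
  let ?S = "SUP l\<in>{0<..}. SUP x\<in>{0<..}. ereal (\<bar>deriv (q l) x\<bar> / l)"
  obtain c where c: "?S \<le> ereal c"
    using assms by (cases ?S) (auto intro: that)
  \<comment> \<open>The maximum with 0 makes the constant nonnegative without inspecting the
    supremum.\<close>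
  have le: "\<bar>deriv (q l) x\<bar> \<le> max c 0 * l" if "l > 0" "x > 0" for l x :: real
  proof -
    have "ereal (\<bar>deriv (q l) x\<bar> / l) \<le> ?S"
      using that by (intro SUP_upper2[of l] SUP_upper2[of x]) auto
    with c have "\<bar>deriv (q l) x\<bar> / l \<le> c"
      by (meson ereal_less_eq(3) order.trans)
    then have "\<bar>deriv (q l) x\<bar> \<le> c * l" using that by (simp add: field_simps)
    also have "\<dots> \<le> max c 0 * l" using that by (intro mult_right_mono) auto
    finally show ?thesis .
  qed
  show ?thesis by (rule that[OF _ le]) auto
qed

theorem theorem1p2:
  fixes X :: "'a::euclidean_space set"
    and \<rho> :: "'a measure"
    and A B0 :: "'a \<Rightarrow> real"
    and B :: "'a \<Rightarrow> 'a \<Rightarrow> real"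
    and \<theta>\<^sub>0 :: "'s::{countable,linorder} \<Rightarrow> 's \<Rightarrow> real"
    and \<mu> :: "('s \<Rightarrow> 'a) measure"
    and P :: "'w measure"
    and Xs :: "nat \<Rightarrow> 'w \<Rightarrow> 's \<Rightarrow> 'a"
    and D :: "nat \<Rightarrow> 's set"
    and q :: "real \<Rightarrow> real \<Rightarrow> real"
    and lam :: "nat \<Rightarrow> real"
  assumes "compact X"
    and "sets \<rho> = sets (restrict_space borel X)"
    and "finite_measure \<rho>"
    and "emeasure \<rho> X \<noteq> 0"
    and "A \<in> borel_measurable \<rho>"
    and "B0 \<in> borel_measurable \<rho>"
    and "(\<lambda>(x, y). B x y) \<in> borel_measurable (\<rho> \<Otimes>\<^sub>M \<rho>)"
    and "\<And>x y. x \<in> X \<Longrightarrow> y \<in> X \<Longrightarrow> B x y = B y x"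
    and "\<And>x. x \<in> X \<Longrightarrow> B x x = B0 x"
    and "infinite (UNIV :: 's set)"
    and "has_full_conditionals \<rho> A B0 B \<theta>\<^sub>0 \<mu>"
    and "prob_space P"
    and "prob_space.indep_vars P (\<lambda>_. Pi\<^sub>M UNIV (\<lambda>_. \<rho>)) Xs {1..}"
    and "\<And>i. i \<ge> 1 \<Longrightarrow> distr P (Pi\<^sub>M UNIV (\<lambda>_. \<rho>)) (Xs i) = \<mu>"
    and "incseq D"
    and "\<And>n. finite (D n)"
    and "(\<Union>n. D n) = UNIV"
    and "\<And>l x. l \<ge> 0 \<Longrightarrow> x \<ge> 0 \<Longrightarrow> q l x \<ge> 0"
    and "\<And>n. lam n > 0"
    and "sup_norm X A < \<infinity>"
    and "sup_norm X B0 < \<infinity>"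
    and "sup_norm (X \<times> X) (\<lambda>(x, y). B x y) < \<infinity>"
    and "\<And>l. l \<ge> 0 \<Longrightarrow> q l 0 = 0"
    and "\<And>l. l \<ge> 0 \<Longrightarrow> continuous (at_right 0) (q l)"
    and "\<And>l x. l \<ge> 0 \<Longrightarrow> x > 0 \<Longrightarrow> q l differentiable at x"
    and "(SUP l\<in>{0<..}. SUP x\<in>{0<..}. ereal (\<bar>deriv (q l) x\<bar> / l)) < \<infinity>"
    and "\<theta>\<^sub>0 \<in> matrices"
    and "\<And>s. finite {l \<in> UNIV - {s}. \<theta>\<^sub>0 s l \<noteq> 0}"
    and "(\<lambda>n. lam n / real n) \<longlonglongrightarrow> 0"
  shows "AE \<omega> in P. epi_converges M1_metric
           (\<lambda>n \<theta>. ereal (U \<rho> A B0 B D q lam \<theta>\<^sub>0 (\<lambda>i. Xs i \<omega>) n \<theta>))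
           (k_total \<rho> A B0 B \<mu> \<theta>\<^sub>0)"
proof -
  have space_\<rho>: "space \<rho> = X"
    using sets_eq_imp_space_eq[OF assms(2)] by (simp add: space_restrict_space)
  obtain a where a: "\<And>u. u \<in> X \<Longrightarrow> \<bar>A u\<bar> \<le> a"
    using sup_norm_bound[OF assms(20)] by blast
  obtain b0 where b0: "\<And>u. u \<in> X \<Longrightarrow> \<bar>B0 u\<bar> \<le> b0"
    using sup_norm_bound[OF assms(21)] by blast
  obtain b where b: "\<And>p. p \<in> X \<times> X \<Longrightarrow> \<bar>case p of (u, v) \<Rightarrow> B u v\<bar> \<le> b"
    using sup_norm_bound[OF assms(22)] by blast
  \<comment> \<open>One constant dominating the three bounds plays the role of
    \<open>C\<close>.\<close>
  interpret bounded_interaction \<rho> A B0 B "max a (max b0 b)"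
  proof (rule bounded_interaction.intro)
    show "finite_measure \<rho>" "emeasure \<rho> (space \<rho>) \<noteq> 0" "A \<in> borel_measurable \<rho>"
      "B0 \<in> borel_measurable \<rho>" "(\<lambda>(x, y). B x y) \<in> borel_measurable (\<rho> \<Otimes>\<^sub>M \<rho>)"
      by (simp_all only: space_\<rho> assms(3-7) not_False_eq_True)
    fix u assume u: "u \<in> space \<rho>"
    show "\<bar>A u\<bar> \<le> max a (max b0 b)" "\<bar>B0 u\<bar> \<le> max a (max b0 b)"
      using a[of u] b0[of u] u by (simp_all add: space_\<rho> le_max_iff_disj)
    fix v assume "v \<in> space \<rho>"
    then show "\<bar>B u v\<bar> \<le> max a (max b0 b)"
      using b[of "(u, v)"] u by (simp add: space_\<rho> le_max_iff_disj)
  qed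
  obtain K where K: "K \<ge> 0" "\<And>l x. l > 0 \<Longrightarrow> x > 0 \<Longrightarrow> \<bar>deriv (q l) x\<bar> \<le> K * l"
    using deriv_quotient_sup_bound[OF assms(26)] by blast
  have lam: "lam n > 0" for n by (rule assms(19))
  \<comment> \<open>The derivative bound is applied at the level \<open>lam n\<close>, whose
    positivity makes \<open>K * lam n\<close> a valid Lipschitz constant.\<close>
  have q_lipschitz: "\<bar>q (lam n) x - q (lam n) y\<bar> \<le> K * lam n * \<bar>x - y\<bar>" if "x \<ge> 0" "y \<ge> 0" for n x y
    by (rule deriv_bounded_imp_lipschitz_nonneg)
       (use that lam[of n] K(2) assms(24,25) in \<open>auto simp: less_imp_le\<close>)
  \<comment> \<open>Both \<open>es\<close> and \<open>s\<close> range over countable types, so a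
    single null set serves all rational matrices and all sites.\<close>
  have "AE \<omega> in P. \<forall>es s. (\<lambda>n. 1 / real n * (\<Sum>i=1..n. log_ratio \<theta>\<^sub>0 (madd \<theta>\<^sub>0 (rational_matrix es)) s (Xs i \<omega>)))
      \<longlonglongrightarrow> k_site \<rho> A B0 B \<mu> \<theta>\<^sub>0 (rational_matrix es) s"
    unfolding AE_all_countable
    by (intro allI AE_average_log_ratio[OF assms(11,27,12,13,14)] M1_matrices rational_matrix_M1) auto
  then show ?thesis
  proof (rule AE_mp, intro AE_I2 impI)
    fix \<omega> assume \<omega>: "\<omega> \<in> space P"
      and average: "\<forall>es s. (\<lambda>n. 1 / real n * (\<Sum>i=1..n. log_ratio \<theta>\<^sub>0 (madd \<theta>\<^sub>0 (rational_matrix es)) s (Xs i \<omega>)))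
        \<longlonglongrightarrow> k_site \<rho> A B0 B \<mu> \<theta>\<^sub>0 (rational_matrix es) s"
    \<comment> \<open>Measurability of each observation places its value in the product space, where
      the pointwise bounds on the interactions apply.\<close>
    have Xs: "Xs i \<omega> \<in> space configs" if "i \<ge> 1" for i
      using assms(13) that \<omega> by (auto simp: prob_space.indep_vars_def[OF assms(12)] intro: measurable_space)
    have K_lam: "K * lam n \<ge> 0" for n using K(1) lam[of n] by simp
    show "epi_converges M1_metric (\<lambda>n \<theta>. ereal (U \<rho> A B0 B D q lam \<theta>\<^sub>0 (\<lambda>i. Xs i \<omega>) n \<theta>))
        (k_total \<rho> A B0 B \<mu> \<theta>\<^sub>0)"
      by (rule epi_converges_if_averages[where D = D and q = q and lam = lam and K = K
            and x = "\<lambda>i. Xs i \<omega>" and \<mu> = \<mu> and \<theta>\<^sub>0 = \<theta>\<^sub>0,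
            OF assms(11,27,16) q_lipschitz K_lam Xs assms(15,17,28,29)])
         (use average in simp_all)
  qed
qed

end
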